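(* Let $C\ge1$, and for $1\le i\le C$ let $N_i\in\{1,2,\dots\}\cup\{\infty\}$ and let $\mathcal{S}_i$ be a Polish space. Let $(X_{n,i})_{1\le n\le N_i,\,1\le i\le C}$ be a multi-exchangeable system, $X_{n,i}$ taking values in $\mathcal{S}_i$, and let $(\Lambda_i^{N_i})_{1\le i\le C}$ be its measure vector (defined below). Then, for $1\le i\le C$, the measure $Q_i$ defined by $Q_i = \lambda^{N_i,N_i}(X_{1,i},\dots,X_{N_i,i})$ if $N_i<\infty$ and $Q_i=(\Lambda_i^{\infty})^{\otimes\infty}$ if $N_i=\infty$ is a measurable function of $\Lambda_i^{N_i}$, and the conditional law of the whole system $(X_{n,i})_{1\le n\le N_i,\,1\le i\le C}$ given $(\Lambda_i^{N_i})_{1\le i\le C}$ is the product measure $Q_1\otimes\cdots\otimes Q_C$. In words: conditionally on $(\Lambda_i^{N_i})_{1\le i\le C}$, the classes are independent, each finite class $i$ being distributed as $N_i$ draws without replacement from the atoms of the empirical measure $\frac1{N_i}\sum_{n=1}^{N_i}\delta_{X_{n,i}}$ counted with multiplicity, and each infinite class being i.i.d. with law its directing measure $\Lambda_i^\infty$.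
   Context: For $k\ge1$, $\Sigma(k)$ is the set of permutations of $\{1,\dots,k\}$ and $\Sigma(\infty)$ is the set of permutations of $\{1,2,\dots\}$ with finite support; $1\le n\le\infty$ means $n\ge1$. A system $(X_{n,i})_{1\le n\le N_i,\,1\le i\le C}$ of random variables, $X_{n,i}$ with values in $\mathcal{S}_i$, is multi-exchangeable if $\mathcal{L}\big((X_{\sigma_i(n),i})_{1\le n\le N_i,1\le i\le C}\big)=\mathcal{L}\big((X_{n,i})_{1\le n\le N_i,1\le i\le C}\big)$ for all $\sigma_i\in\Sigma(N_i)$, $1\le i\le C$. In particular each class $(X_{n,i})_{n}$ is exchangeable; if $N_i=\infty$, by de Finetti's theorem the limit $\Lambda_i^\infty=\lim_{N\to\infty}\frac1N\sum_{n=1}^N\delta_{X_{n,i}}$ exists a.s. in the weak topology of $\mathcal{P}(\mathcal{S}_i)$ (the directing measure). The measure vector is $(\Lambda_i^{N_i})_{1\le i\le C}$ with values in $\mathcal{P}(\mathcal{S}_1)\times\cdots\times\mathcal{P}(\mathcal{S}_C)$, where $\Lambda_i^{N_i}=\frac1{N_i}\sum_{n=1}^{N_i}\delta_{X_{n,i}}$ (empirical measure) if $N_i<\infty$ and $\Lambda_i^{N_i}=\Lambda_i^\infty$ (directing measure) if $N_i=\infty$. For $1\le k\le N$ finite, $\lambda^{N,k}(x_1,\dots,x_N)=\frac1{(N)_k}\sum_{1\le n_1,\dots,n_k\le N\text{ distinct}}\delta_{(x_{n_1},\dots,x_{n_k})}\in\mathcal{P}(\mathcal{S}^k)$ with $(N)_k=N(N-1)\cdots(N-k+1)$;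 it depends only on $\frac1N\sum_{n=1}^N\delta_{x_n}$. Spaces of probability measures carry the weak topology. *)

theory Defs
  imports "HOL-Probability.Probability" "HOL-Combinatorics.Permutations"
begin

definition Polish_space :: "'a topology \<Rightarrow> bool" where
  "Polish_space X \<longleftrightarrow> completely_metrizable_space X \<and> separable_space X"

definition borel_of :: "'a topology \<Rightarrow> 'a measure" where
  "borel_of X = sigma (topspace X) {U. openin X U}"

definition idx :: "enat \<Rightarrow> nat set" where
  "idx N = {n. 1 \<le> n \<and> enat n \<le> N}"

definition empirical :: "'a measure \<Rightarrow> nat \<Rightarrow> (nat \<Rightarrow> 'a) \<Rightarrow> 'a measure" where
  "empirical M N x = measure_of (space M) (sets M)
     (\<lambda>A. ennreal (real (card {n\<in>{1..N}. x n \<in> A}) / real N))"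

definition lambda_Nk :: "'a measure \<Rightarrow> nat \<Rightarrow> nat \<Rightarrow> (nat \<Rightarrow> 'a) \<Rightarrow> (nat \<Rightarrow> 'a) measure" where
  "lambda_Nk M N k x = measure_of (space (PiM {1..k} (\<lambda>_. M))) (sets (PiM {1..k} (\<lambda>_. M)))
     (\<lambda>A. ennreal (real (card {f \<in> {1..k} \<rightarrow>\<^sub>E {1..N}. inj_on f {1..k} \<and>
                                  (\<lambda>j\<in>{1..k}. x (f j)) \<in> A})
                  / (fact N / fact (N - k))))"

definition weak_conv_on :: "'a topology \<Rightarrow> (nat \<Rightarrow> 'a measure) \<Rightarrow> 'a measure \<Rightarrow> bool" where
  "weak_conv_on X \<mu>s \<mu> \<longleftrightarrow>
     (\<forall>f. continuous_map X euclideanreal f \<and> bounded (f ` topspace X) \<longrightarrow>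
          (\<lambda>N. \<integral>x. f x \<partial>\<mu>s N) \<longlonglongrightarrow> (\<integral>x. f x \<partial>\<mu>))"

definition multi_exchangeable ::
  "'w measure \<Rightarrow> nat \<Rightarrow> (nat \<Rightarrow> enat) \<Rightarrow> (nat \<Rightarrow> 'a topology) \<Rightarrow> ('w \<Rightarrow> nat \<Rightarrow> nat \<Rightarrow> 'a) \<Rightarrow> bool" where
  "multi_exchangeable M C N S X \<longleftrightarrow>
     (\<forall>\<sigma>. (\<forall>i\<in>{1..C}. \<sigma> i permutes idx (N i) \<and> finite {n. \<sigma> i n \<noteq> n}) \<longrightarrow>
        distr M (PiM {1..C} (\<lambda>i. PiM (idx (N i)) (\<lambda>_. borel_of (S i))))
          (\<lambda>\<omega>. \<lambda>i\<in>{1..C}. \<lambda>n\<in>idx (N i). X \<omega> i (\<sigma> i n))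
        = distr M (PiM {1..C} (\<lambda>i. PiM (idx (N i)) (\<lambda>_. borel_of (S i))))
          (\<lambda>\<omega>. \<lambda>i\<in>{1..C}. \<lambda>n\<in>idx (N i). X \<omega> i n))"

definition measure_vector ::
  "'w measure \<Rightarrow> nat \<Rightarrow> (nat \<Rightarrow> enat) \<Rightarrow> (nat \<Rightarrow> 'a topology) \<Rightarrow> ('w \<Rightarrow> nat \<Rightarrow> nat \<Rightarrow> 'a)
    \<Rightarrow> (nat \<Rightarrow> 'w \<Rightarrow> 'a measure) \<Rightarrow> bool" where
  "measure_vector M C N S X \<Lambda> \<longleftrightarrow>
     (\<forall>i\<in>{1..C}.
        (N i \<noteq> \<infinity> \<longrightarrow> (\<forall>\<omega>\<in>space M. \<Lambda> i \<omega> = empirical (borel_of (S i)) (the_enat (N i)) (X \<omega> i))) \<and>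
        (N i = \<infinity> \<longrightarrow> \<Lambda> i \<in> M \<rightarrow>\<^sub>M prob_algebra (borel_of (S i)) \<and>
           (AE \<omega> in M. weak_conv_on (S i) (\<lambda>K. empirical (borel_of (S i)) K (X \<omega> i)) (\<Lambda> i \<omega>))))"

definition Q_meas ::
  "(nat \<Rightarrow> enat) \<Rightarrow> (nat \<Rightarrow> 'a topology) \<Rightarrow> ('w \<Rightarrow> nat \<Rightarrow> nat \<Rightarrow> 'a)
    \<Rightarrow> (nat \<Rightarrow> 'w \<Rightarrow> 'a measure) \<Rightarrow> nat \<Rightarrow> 'w \<Rightarrow> (nat \<Rightarrow> 'a) measure" where
  "Q_meas N S X \<Lambda> i \<omega> =
     (if N i = \<infinity> then PiM (idx (N i)) (\<lambda>_. \<Lambda> i \<omega>)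
      else lambda_Nk (borel_of (S i)) (the_enat (N i)) (the_enat (N i)) (X \<omega> i))"

end

theory Submission
  imports Defs
begin

text \<open>
  Permuting the indices inside each class leaves the measure vector unchanged almost surely, so the joint
  law of the system and its measure vector is invariant under all system permutations. Hence, on an event
  depending on the measure vector only, a product of class-wise test functions may be replaced by the
  product of its averages over any finite families of permutations, one family per class. For a finite
  class, averaging over all permutations gives exactly the integral against the law of a draw without
  replacement. For an infinite class, averaging the \<open>n\<close>-th variable over the \<open>n\<close>-th of a sequence of growing
  disjoint blocks and letting the block length tend to infinity gives the integral against the i.i.d. law.
  Continuous test functions determine the laws by approximation of closed sets and a
  \<open>\<pi>\<close>-\<open>\<lambda>\<close> argument.
\<close>

text \<open>Two facts about an infinite class shape the proof. Its \<open>\<Lambda> i\<close> is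
  fixed only almost surely, so the measure vector is not an exact function of the sample, and its
  events have to be compared between the original and the permuted system modulo null sets. And
  convergence of empirical measures is known only against bounded continuous functions, so a closed
  set enters only through a pointwise limit of such functions. A finite class poses a different
  problem: the law of the draw must depend measurably on the empirical measure alone, although its
  atoms come without an order. An i.i.d. sample from \<open>\<mu>\<close> is exchangeable, so
  conditioning it on having empirical measure \<open>\<mu>\<close> makes all orderings of the atoms
  equally likely and yields that law without listing them. Conditional independence comes from the
  freedom to permute each class separately: a product of class averages expands into an average over
  families of permutations, and each family is one admissible permutation of the system.\<close>

declare One_nat_def [simp del]

section \<open>Borel sets of Polish spaces\<close>

lemma sets_borel_of: "sets (borel_of S) = sigma_sets (topspace S) {U. openin S U}"
  unfolding borel_of_def by (rule sets_measure_of) (auto dest: openin_subset)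

lemma space_borel_of [simp]: "space (borel_of S) = topspace S"
  unfolding borel_of_def by (rule space_measure_of) (auto dest: openin_subset)

lemma openin_in_sets_borel_of: "openin S U \<Longrightarrow> U \<in> sets (borel_of S)"
  by (auto simp: sets_borel_of)

lemma closedin_in_sets_borel_of: "closedin S F \<Longrightarrow> F \<in> sets (borel_of S)"
proof -
  assume "closedin S F"
  then have "openin S (topspace S - F)" "F = space (borel_of S) - (topspace S - F)"
    by (auto simp: closedin_def)
  then show "F \<in> sets (borel_of S)"
    by (metis openin_in_sets_borel_of sets.compl_sets)
qed

text \<open>Complements exchange open and closed sets. Closed sets are the convenient generator
  here: they are stable under intersection, and in a metrizable space their indicators are limits of
  continuous functions.\<close>

lemma sets_borel_of_closedin: "sets (borel_of S) = sigma_sets (topspace S) {F. closedin S F}"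
proof
  have "{F. closedin S F} \<subseteq> sets (borel_of S)"
    by (simp add: subset_iff closedin_in_sets_borel_of)
  from sets.sigma_sets_subset[OF this]
  show "sigma_sets (topspace S) {F. closedin S F} \<subseteq> sets (borel_of S)"
    by simp
  have "U \<in> sigma_sets (topspace S) {F. closedin S F}" if "openin S U" for U
  proof -
    have "topspace S - (topspace S - U) \<in> sigma_sets (topspace S) {F. closedin S F}"
      using that by (intro sigma_sets.Compl sigma_sets.Basic) auto
    then show ?thesis
      using double_diff[OF openin_subset[OF that], of "topspace S"] by simp
  qed
  then show "sets (borel_of S) \<subseteq> sigma_sets (topspace S) {F. closedin S F}"
    unfolding sets_borel_of by (intro sigma_sets_mono subsetI) simp
qed

lemma continuous_map_borel_of:
  assumes "continuous_map S euclideanreal f"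
  shows "f \<in> borel_measurable (borel_of S)"
proof (rule borel_measurableI)
  fix U :: "real set" assume "open U"
  then have "openin S {x \<in> topspace S. f x \<in> U}"
    using assms by (auto simp: continuous_map_def)
  moreover have "f -` U \<inter> space (borel_of S) = {x \<in> topspace S. f x \<in> U}"
    by auto
  ultimately show "f -` U \<inter> space (borel_of S) \<in> sets (borel_of S)"
    by (simp add: openin_in_sets_borel_of)
qed

section \<open>Singletons, countable generators and continuous approximation in Polish
  spaces\<close>

lemma Polish_space_singleton_borel_of:
  assumes "Polish_space S" "x \<in> topspace S"
  shows "{x} \<in> sets (borel_of S)"
  using assms completely_metrizable_imp_metrizable_space metrizable_imp_t1_space
  by (auto simp: Polish_space_def t1_space_closedin_singleton intro!: closedin_in_sets_borel_of)

text \<open>The base consists of the balls of radius \<open>1 / real (Suc n)\<close> around the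
  points of a countable dense set.\<close>

lemma Polish_space_countable_base:
  assumes "Polish_space S"
  obtains \<B> where "countable \<B>" "\<And>B. B \<in> \<B> \<Longrightarrow> openin S B"
    "\<And>U. openin S U \<Longrightarrow> U = \<Union>{B \<in> \<B>. B \<subseteq> U}"
proof -
  have "metrizable_space S" "separable_space S"
    using assms by (auto simp: Polish_space_def intro: completely_metrizable_imp_metrizable_space)
  then obtain M d where "Metric_space M d" and S: "S = Metric_space.mtopology M d"
    by (auto simp: metrizable_space_def)
  then interpret Metric_space M d by simp
  from \<open>separable_space S\<close> obtain D where D: "countable D" "D \<subseteq> M" "S closure_of D = M"
    by (auto simp: separable_space_def S)
  define \<B> where "\<B> = (\<lambda>(x, n). mball x (1 / real (Suc n))) ` (D \<times> (UNIV :: nat set))"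
  show thesis
  proof
    show "countable \<B>"
      unfolding \<B>_def using D by (intro countable_image countable_SIGMA) auto
    show "openin S B" if "B \<in> \<B>" for B
      using that by (auto simp: \<B>_def S)
    fix U assume U: "openin S U"
    show "U = \<Union>{B \<in> \<B>. B \<subseteq> U}"
    proof (intro set_eqI iffI)
      fix x assume x: "x \<in> U"
      then have "x \<in> M" using U openin_subset[OF U] by (auto simp: S)
      from x U obtain r where r: "r > 0" "mball x r \<subseteq> U"
        by (auto simp: S openin_mtopology)
      \<comment> \<open>Half of \<open>r\<close>, because two steps are made: from \<open>x\<close>
        to the centre \<open>y\<close>, and from \<open>y\<close> to an arbitrary point of its
        ball.\<close>
      from r obtain n where n: "1 / real (Suc n) < r / 2"
        using reals_Archimedean[of "r / 2"] by (auto simp: inverse_eq_divide)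
      have "x \<in> S closure_of D" using D \<open>x \<in> M\<close> by simp
      then obtain y where y: "y \<in> D" "y \<in> mball x (1 / real (Suc n))"
        unfolding S metric_closure_of by (auto dest!: spec[of _ "1 / real (Suc n)"])
      have yM: "y \<in> M" using y D by auto
      have "mball y (1 / real (Suc n)) \<subseteq> mball x r"
      proof
        fix z assume "z \<in> mball y (1 / real (Suc n))"
        then have "z \<in> M" "d y z < 1 / real (Suc n)" by auto
        moreover have "d x y < 1 / real (Suc n)" using y by auto
        moreover have "d x z \<le> d x y + d y z"
          using \<open>x \<in> M\<close> yM \<open>z \<in> M\<close> by (rule triangle)
        ultimately show "z \<in> mball x r" using n \<open>x \<in> M\<close> by auto
      qed
      moreover have "x \<in> mball y (1 / real (Suc n))"
        using y yM \<open>x \<in> M\<close> by (auto simp: commute)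
      moreover have "mball y (1 / real (Suc n)) \<in> \<B>"
        unfolding \<B>_def using y(1) by (intro image_eqI[of _ _ "(y, n)"]) simp_all
      ultimately show "x \<in> \<Union>{B \<in> \<B>. B \<subseteq> U}"
        using r(2) by blast
    qed blast
  qed
qed

text \<open>Finite intersections of base sets form such a family. Its countability turns equality of
  two probability measures into countably many real equations, and this is what makes the graph of
  the empirical measure map measurable.\<close>

lemma Polish_space_countable_Int_stable_generator:
  assumes "Polish_space S"
  obtains \<A> where "countable \<A>" "Int_stable \<A>" "\<A> \<subseteq> Pow (topspace S)"
    "topspace S \<in> \<A>" "sets (borel_of S) = sigma_sets (topspace S) \<A>"
proof -
  obtain \<B> where \<B>: "countable \<B>" "\<And>B. B \<in> \<B> \<Longrightarrow> openin S B"
    "\<And>U. openin S U \<Longrightarrow> U = \<Union>{B \<in> \<B>. B \<subseteq> U}"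
    using Polish_space_countable_base[OF assms] by blast
  \<comment> \<open>Intersecting with \<open>topspace S\<close> gives the empty family the value
    \<open>topspace S\<close> instead of the whole type.\<close>
  define \<A> where "\<A> = (\<lambda>\<F>. topspace S \<inter> \<Inter>\<F>) ` {\<F>. finite \<F> \<and> \<F> \<subseteq> \<B>}"
  have op: "openin S A" if "A \<in> \<A>" for A
  proof -
    from that obtain \<F> where "finite \<F>" "\<F> \<subseteq> \<B>" "A = topspace S \<inter> \<Inter>\<F>"
      by (auto simp: \<A>_def)
    then show ?thesis
      using \<B>(2) by (cases "\<F> = {}") (auto intro!: openin_Inter openin_Int)
  qed
  show thesis
  proof
    show "countable \<A>"
      unfolding \<A>_def using \<B>(1) by (intro countable_image countable_Collect_finite_subset)
    show "Int_stable \<A>"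
    proof (rule Int_stableI)
      fix a b assume "a \<in> \<A>" "b \<in> \<A>"
      then obtain F G where "finite F" "F \<subseteq> \<B>" "a = topspace S \<inter> \<Inter>F"
        "finite G" "G \<subseteq> \<B>" "b = topspace S \<inter> \<Inter>G" by (auto simp: \<A>_def)
      then show "a \<inter> b \<in> \<A>"
        unfolding \<A>_def by (intro image_eqI[of _ _ "F \<union> G"]) auto
    qed
    show "\<A> \<subseteq> Pow (topspace S)" by (auto simp: \<A>_def)
    show "topspace S \<in> \<A>" unfolding \<A>_def by (intro image_eqI[of _ _ "{}"]) auto
    have "U \<in> sigma_sets (topspace S) \<A>" if "openin S U" for U
    proof -
      have "\<Union>{B \<in> \<B>. B \<subseteq> U} \<in> sigma_sets (topspace S) \<A>"
      proof (rule sigma_sets_UNION)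
        show "countable {B \<in> \<B>. B \<subseteq> U}" using \<B>(1) by simp
        fix B assume "B \<in> {B \<in> \<B>. B \<subseteq> U}"
        then show "B \<in> sigma_sets (topspace S) \<A>"
          using openin_subset[OF \<B>(2)] unfolding \<A>_def
          by (intro sigma_sets.Basic image_eqI[of _ _ "{B}"]) auto
      qed
      with \<B>(3)[OF that] show ?thesis by simp
    qed
    then show "sets (borel_of S) = sigma_sets (topspace S) \<A>"
      unfolding sets_borel_of using op
      by (intro antisym sigma_sets_mono) auto
  qed
qed

text \<open>A closed set is a decreasing intersection of open sets \<open>C n\<close>. Urysohn
  functions that are 1 on \<open>F\<close> and 0 off \<open>C n\<close> converge: a point outside
  \<open>F\<close> lies outside \<open>C n\<close> from some \<open>n\<close> on.\<close>

lemma Polish_space_closedin_indicator_limit: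
  assumes "Polish_space S" "closedin S F"
  obtains g :: "nat \<Rightarrow> 'a \<Rightarrow> real" where
    "\<And>m. continuous_map S euclideanreal (g m)"
    "\<And>m x. x \<in> topspace S \<Longrightarrow> 0 \<le> g m x \<and> g m x \<le> 1"
    "\<And>x. x \<in> topspace S \<Longrightarrow> (\<lambda>m. g m x) \<longlonglongrightarrow> indicator F x"
proof -
  have met: "metrizable_space S"
    using assms by (auto simp: Polish_space_def intro: completely_metrizable_imp_metrizable_space)
  obtain C where C: "\<And>n. openin S (C n)" "\<And>n. C (Suc n) \<subseteq> C n" "\<Inter>(range C) = F"
    using closed_imp_gdelta_in[OF met assms(2)] by (auto simp: gdelta_in_descending)
  have dec: "C m \<subseteq> C n" if "n \<le> m" for n m
    using C(2) that by (rule lift_Suc_antimono_le)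
  have "\<exists>f. continuous_map S (top_of_set {0..1::real}) f \<and> f ` (topspace S - C n) \<subseteq> {0} \<and> f ` F \<subseteq> {1}" for n
  proof -
    have "closedin S (topspace S - C n)" "disjnt (topspace S - C n) F"
      using C by (auto simp: disjnt_def)
    then show ?thesis
      using Urysohn_lemma[OF metrizable_imp_normal_space[OF met] _ assms(2), of "topspace S - C n" 0 1]
      by (metis zero_le_one)
  qed
  then obtain g where g: "\<And>n. continuous_map S (top_of_set {0..1::real}) (g n)"
    "\<And>n. g n ` (topspace S - C n) \<subseteq> {0}" "\<And>n. g n ` F \<subseteq> {1}"
    by metis
  show thesis
  proof
    show "continuous_map S euclideanreal (g m)" for m
      using g(1)[of m] by (simp add: continuous_map_in_subtopology)
    show "0 \<le> g m x \<and> g m x \<le> 1" if "x \<in> topspace S" for m x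
      using g(1)[of m] that by (force simp: continuous_map_in_subtopology)
    show "(\<lambda>m. g m x) \<longlonglongrightarrow> indicator F x" if x: "x \<in> topspace S" for x
    proof (cases "x \<in> F")
      case True
      then have "g m x = 1" for m using g(3)[of m] by auto
      then show ?thesis using True by simp
    next
      case False
      then obtain n where "x \<notin> C n" using C(3) by auto
      then have "g m x = 0" if "m \<ge> n" for m
        using dec[OF that] g(2)[of m] x by auto
      then show ?thesis
        using False by (auto intro!: tendsto_eventually eventually_sequentiallyI[of n])
    qed
  qed
qed

section \<open>Empirical measures and draws without replacement\<close>

text \<open>The set function is the law of \<open>x\<close> at a uniformly chosen index. Hence it
  really is a measure, \<open>measure_of\<close> returns it unchanged, and integrals become finite
  averages.\<close>

lemma empirical_eq_distr:
  assumes "n \<ge> 1" "x \<in> {1..n} \<rightarrow> space M"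
  shows "empirical M n x = distr (uniform_count_measure {1..n}) M x"
proof -
  let ?D = "distr (uniform_count_measure {1..n}) M x"
  have m: "x \<in> uniform_count_measure {1..n} \<rightarrow>\<^sub>M M"
    using assms by (auto simp: measurable_def space_uniform_count_measure sets_uniform_count_measure)
  have "empirical M n x = measure_of (space M) (sets M) (emeasure ?D)"
    unfolding empirical_def
  proof (rule measure_of_eq[OF sets.space_closed])
    fix A assume "A \<in> sigma_sets (space M) (sets M)"
    then have A: "A \<in> sets M" by (simp add: sets.sigma_sets_eq)
    have "x -` A \<inter> {1..n} = {k \<in> {1..n}. x k \<in> A}" by auto
    then show "ennreal (real (card {k \<in> {1..n}. x k \<in> A}) / real n) = emeasure ?D A"
      using A m by (simp add: emeasure_distr emeasure_uniform_count_measure space_uniform_count_measure subset_iff)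
  qed
  also have "\<dots> = ?D"
    using measure_of_of_measure[of ?D] by simp
  finally show ?thesis .
qed

lemma sets_empirical [simp, measurable_cong]: "sets (empirical M n x) = sets M"
  unfolding empirical_def by (simp add: sets.space_closed sets.sigma_sets_eq)

lemma space_empirical [simp]: "space (empirical M n x) = space M"
  by (rule sets_eq_imp_space_eq) simp

lemma measurable_uniform_count_measure:
  "x \<in> A \<rightarrow> space M \<Longrightarrow> x \<in> uniform_count_measure A \<rightarrow>\<^sub>M M"
  by (auto simp: measurable_def space_uniform_count_measure sets_uniform_count_measure)

lemma prob_space_empirical:
  assumes "n \<ge> 1" "x \<in> {1..n} \<rightarrow> space M"
  shows "prob_space (empirical M n x)"
  using assms by (auto simp: empirical_eq_distr
      intro!: prob_space.prob_space_distr prob_space_uniform_count_measure measurable_uniform_count_measure)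

lemma measure_empirical:
  assumes "n \<ge> 1" "x \<in> {1..n} \<rightarrow> space M" "A \<in> sets M"
  shows "measure (empirical M n x) A = real (card {k \<in> {1..n}. x k \<in> A}) / real n"
proof -
  have "x -` A \<inter> {1..n} = {k \<in> {1..n}. x k \<in> A}" by auto
  then show ?thesis
    using assms by (simp add: empirical_eq_distr measure_distr measurable_uniform_count_measure
        measure_uniform_count_measure space_uniform_count_measure subset_iff)
qed

lemma integral_empirical:
  fixes f :: "'a \<Rightarrow> real"
  assumes "n \<ge> 1" "x \<in> {1..n} \<rightarrow> space M" "f \<in> borel_measurable M"
  shows "(\<integral>y. f y \<partial>empirical M n x) = (\<Sum>k=1..n. f (x k)) / real n"
  using assms by (simp add: empirical_eq_distr integral_distr measurable_uniform_count_measure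
      integral_uniform_count_measure)

lemma measurable_permute_uniform:
  assumes x: "x \<in> {1..n} \<rightarrow> space M"
  shows "(\<lambda>p. \<lambda>j\<in>{1..n}. x (p j)) \<in> uniform_count_measure {p. p permutes {1..n}} \<rightarrow>\<^sub>M PiM {1..n} (\<lambda>_. M)"
proof (intro measurable_uniform_count_measure funcsetI)
  fix p assume "p \<in> {p. p permutes {1..n}}"
  then have "p j \<in> {1..n}" if "j \<in> {1..n}" for j
    using permutes_in_image[of p "{1..n}" j] that by simp
  then show "(\<lambda>j\<in>{1..n}. x (p j)) \<in> space (PiM {1..n} (\<lambda>_. M))"
    using x by (simp add: space_PiM PiE_iff Pi_iff)
qed

text \<open>For \<open>k = n\<close> the injective index maps are exactly the restrictions of
  permutations, so drawing everything without replacement means reading \<open>x\<close> in a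
  uniformly random order.\<close>

lemma lambda_Nk_eq_distr:
  assumes x: "x \<in> {1..n} \<rightarrow> space M"
  shows "lambda_Nk M n n x = distr (uniform_count_measure {p. p permutes {1..n}})
    (PiM {1..n} (\<lambda>_. M)) (\<lambda>p. \<lambda>j\<in>{1..n}. x (p j))"
proof -
  let ?P = "PiM {1..n} (\<lambda>_. M)"
  let ?D = "distr (uniform_count_measure {p. p permutes {1..n}}) ?P (\<lambda>p. \<lambda>j\<in>{1..n}. x (p j))"
  note m = measurable_permute_uniform[OF x]
  have "lambda_Nk M n n x = measure_of (space ?P) (sets ?P) (emeasure ?D)"
    unfolding lambda_Nk_def
  proof (rule measure_of_eq[OF sets.space_closed])
    fix A assume "A \<in> sigma_sets (space ?P) (sets ?P)"
    then have A: "A \<in> sets ?P" by (simp add: sets.sigma_sets_eq)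
    have "bij_betw (\<lambda>p. restrict p {1..n})
       {p. p permutes {1..n} \<and> (\<lambda>j\<in>{1..n}. x (p j)) \<in> A}
       {f \<in> {1..n} \<rightarrow>\<^sub>E {1..n}. inj_on f {1..n} \<and> (\<lambda>j\<in>{1..n}. x (f j)) \<in> A}"
    \<comment> \<open>An injective self-map of the finite set \<open>{1..n}\<close> is onto;
      continuing it by the identity outside gives the unique permutation that restricts to
      it.\<close>
    proof (rule bij_betwI[where g = "\<lambda>f j. if j \<in> {1..n} then f j else j"])
      show "(\<lambda>p. restrict p {1..n}) \<in> {p. p permutes {1..n} \<and> (\<lambda>j\<in>{1..n}. x (p j)) \<in> A} \<rightarrow>
         {f \<in> {1..n} \<rightarrow>\<^sub>E {1..n}. inj_on f {1..n} \<and> (\<lambda>j\<in>{1..n}. x (f j)) \<in> A}"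
      proof (intro funcsetI CollectI conjI)
        fix p assume p: "p \<in> {p. p permutes {1..n} \<and> (\<lambda>j\<in>{1..n}. x (p j)) \<in> A}"
        then have perm: "p permutes {1..n}" by (simp only: mem_Collect_eq)
        show "restrict p {1..n} \<in> {1..n} \<rightarrow>\<^sub>E {1..n}"
          using permutes_in_image[OF perm] by (simp only: restrict_PiE_iff) blast
        show "inj_on (restrict p {1..n}) {1..n}"
          using permutes_inj_on[OF perm, of "{1..n}"] by simp
        have "(\<lambda>j\<in>{1..n}. x (restrict p {1..n} j)) = (\<lambda>j\<in>{1..n}. x (p j))"
          by (intro restrict_ext) simp
        then show "(\<lambda>j\<in>{1..n}. x (restrict p {1..n} j)) \<in> A"
          using p by (simp only: mem_Collect_eq)
      qed
      show "(\<lambda>f j. if j \<in> {1..n} then f j else j) \<in>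
         {f \<in> {1..n} \<rightarrow>\<^sub>E {1..n}. inj_on f {1..n} \<and> (\<lambda>j\<in>{1..n}. x (f j)) \<in> A} \<rightarrow>
         {p. p permutes {1..n} \<and> (\<lambda>j\<in>{1..n}. x (p j)) \<in> A}"
      proof (intro funcsetI CollectI conjI)
        fix f assume f: "f \<in> {f \<in> {1..n} \<rightarrow>\<^sub>E {1..n}. inj_on f {1..n} \<and> (\<lambda>j\<in>{1..n}. x (f j)) \<in> A}"
        then have fS: "f ` {1..n} \<subseteq> {1..n}" and inj: "inj_on f {1..n}" by (auto simp: PiE_def)
        then have "bij_betw f {1..n} {1..n}"
          using endo_inj_surj[OF _ fS inj] by (simp add: bij_betw_def)
        then have "bij_betw (\<lambda>j. if j \<in> {1..n} then f j else j) {1..n} {1..n}"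
          by (rule bij_betw_cong[THEN iffD1, rotated]) simp
        then show "(\<lambda>j. if j \<in> {1..n} then f j else j) permutes {1..n}"
          by (rule bij_imp_permutes) auto
        have "(\<lambda>j\<in>{1..n}. x (if j \<in> {1..n} then f j else j)) = (\<lambda>j\<in>{1..n}. x (f j))"
          by (intro restrict_ext) simp
        then show "(\<lambda>j\<in>{1..n}. x (if j \<in> {1..n} then f j else j)) \<in> A"
          using f by (metis (no_types, lifting) mem_Collect_eq)
      qed
    next
      fix p assume "p \<in> {p. p permutes {1..n} \<and> (\<lambda>j\<in>{1..n}. x (p j)) \<in> A}"
      then have "p permutes {1..n}" by (simp only: mem_Collect_eq)
      then have *: "p j = j" if "j \<notin> {1..n}" for j
        using that by (rule permutes_not_in)
      show "(\<lambda>j. if j \<in> {1..n} then restrict p {1..n} j else j) = p"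
      proof
        show "(if j \<in> {1..n} then restrict p {1..n} j else j) = p j" for j
          using *[of j] by (cases "j \<in> {1..n}") simp_all
      qed
    next
      fix f assume "f \<in> {f \<in> {1..n} \<rightarrow>\<^sub>E {1..n}. inj_on f {1..n} \<and> (\<lambda>j\<in>{1..n}. x (f j)) \<in> A}"
      then have *: "f \<in> extensional {1..n}" by (auto simp: PiE_def)
      show "(\<lambda>j\<in>{1..n}. if j \<in> {1..n} then f j else j) = f"
      proof
        show "(\<lambda>j\<in>{1..n}. if j \<in> {1..n} then f j else j) j = f j" for j
          using extensional_arb[OF *, of j] by (cases "j \<in> {1..n}") simp_all
      qed
    qed
    then have c: "card {f \<in> {1..n} \<rightarrow>\<^sub>E {1..n}. inj_on f {1..n} \<and> (\<lambda>j\<in>{1..n}. x (f j)) \<in> A}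
       = card {p. p permutes {1..n} \<and> (\<lambda>j\<in>{1..n}. x (p j)) \<in> A}"
      by (auto dest: bij_betw_same_card)
    let ?E = "{p. p permutes {1..n} \<and> (\<lambda>j\<in>{1..n}. x (p j)) \<in> A}"
    have E: "(\<lambda>p. \<lambda>j\<in>{1..n}. x (p j)) -` A \<inter> {p. p permutes {1..n}} = ?E" by blast
    have "emeasure ?D A = emeasure (uniform_count_measure {p. p permutes {1..n}}) ?E"
      using emeasure_distr[OF m A] by (simp only: space_uniform_count_measure E)
    also have "\<dots> = ennreal (real (card ?E) / real (card {p. p permutes {1..n}}))"
      by (rule emeasure_uniform_count_measure) (auto intro: finite_permutations)
    also have "card {p. p permutes {1..n}} = fact n"
      by (rule card_permutations) simp_all
    finally show "ennreal (real (card {f \<in> {1..n} \<rightarrow>\<^sub>E {1..n}. inj_on f {1..n} \<and> (\<lambda>j\<in>{1..n}. x (f j)) \<in> A})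
        / (fact n / fact (n - n))) = emeasure ?D A"
      unfolding c by (simp only: diff_self_eq_0 fact_0 div_by_1 of_nat_fact)
  qed
  also have "\<dots> = ?D"
    using measure_of_of_measure[of ?D] by (simp only: space_distr sets_distr)
  finally show ?thesis .
qed

lemma sets_lambda_Nk [simp, measurable_cong]: "sets (lambda_Nk M n k x) = sets (PiM {1..k} (\<lambda>_. M))"
  unfolding lambda_Nk_def by (simp only: sets_measure_of[OF sets.space_closed] sets.sigma_sets_eq)

lemma prob_space_lambda_Nk:
  assumes "x \<in> {1..n} \<rightarrow> space M"
  shows "prob_space (lambda_Nk M n n x)"
proof -
  have "id permutes {1..n}" by (rule permutes_id)
  then have "{p. p permutes {1..n}} \<noteq> {}" by blast
  then show ?thesis
    unfolding lambda_Nk_eq_distr[OF assms]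
    by (intro prob_space.prob_space_distr prob_space_uniform_count_measure measurable_permute_uniform assms)
      (auto simp: finite_permutations)
qed

lemma integral_lambda_Nk:
  fixes f :: "(nat \<Rightarrow> 'a) \<Rightarrow> real"
  assumes "x \<in> {1..n} \<rightarrow> space M" "f \<in> borel_measurable (PiM {1..n} (\<lambda>_. M))"
  shows "(\<integral>y. f y \<partial>lambda_Nk M n n x) = (\<Sum>p | p permutes {1..n}. f (\<lambda>j\<in>{1..n}. x (p j))) / fact n"
  using assms by (simp add: lambda_Nk_eq_distr integral_distr measurable_permute_uniform
      integral_uniform_count_measure finite_permutations card_permutations)

text \<open>Counting fibres over singletons, equality of empirical measures means equality of multisets.\<close>
lemma lambda_Nk_eq_of_empirical_eq:
  assumes n: "n \<ge> 1" and x: "x \<in> {1..n} \<rightarrow> space M" and y: "y \<in> {1..n} \<rightarrow> space M"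
    and single: "\<And>v. v \<in> space M \<Longrightarrow> {v} \<in> sets M"
    and eq: "empirical M n x = empirical M n y"
  shows "lambda_Nk M n n x = lambda_Nk M n n y"
proof -
  have cnt: "card {k \<in> {1..n}. x k = v} = card {k \<in> {1..n}. y k = v}" for v
  proof (cases "v \<in> space M")
    case True
    then show ?thesis
      using arg_cong[OF eq, of "\<lambda>\<mu>. measure \<mu> {v}"] n single[OF True]
      by (simp add: measure_empirical x y)
  next
    case False
    then have "{k \<in> {1..n}. x k = v} = {}" "{k \<in> {1..n}. y k = v} = {}" using x y by auto
    then show ?thesis by metis
  qed
  have "image_mset x (mset_set {1..n}) = image_mset y (mset_set {1..n})"
  proof (rule multiset_eqI)
    fix v
    have "{k \<in> {1..n}. v = x k} = {k \<in> {1..n}. x k = v}" "{k \<in> {1..n}. v = y k} = {k \<in> {1..n}. y k = v}"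
      by auto
    then show "count (image_mset x (mset_set {1..n})) v = count (image_mset y (mset_set {1..n})) v"
      using cnt[of v] by (simp add: count_image_mset' flip: card_eq_sum)
  qed
  then obtain q where q: "q permutes {1..n}" "\<forall>k\<in>{1..n}. x k = y (q k)"
    using image_mset_eq_implies_permutes[of "{1..n}" x y] by auto
  show ?thesis
  proof (rule measure_eqI)
    fix A assume "A \<in> sets (lambda_Nk M n n x)"
    then have A: "A \<in> sets (PiM {1..n} (\<lambda>_. M))" by simp
    have *: "(\<lambda>j\<in>{1..n}. x (p j)) = (\<lambda>j\<in>{1..n}. y ((q \<circ> p) j))" if "p permutes {1..n}" for p
      using q(2) permutes_in_image[OF that] by (intro restrict_ext) auto
    have "measure (lambda_Nk M n n x) A = (\<integral>z. indicator A z \<partial>lambda_Nk M n n x)"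
      using A by simp
    also have "\<dots> = (\<Sum>p | p permutes {1..n}. indicator A (\<lambda>j\<in>{1..n}. y ((q \<circ> p) j))) / fact n"
      using A x by (subst integral_lambda_Nk) (auto intro!: sum.cong simp: *)
    \<comment> \<open>Composition with the fixed \<open>q\<close> only reorders the sum over all
      permutations.\<close>
    also have "(\<Sum>p | p permutes {1..n}. indicator A (\<lambda>j\<in>{1..n}. y ((q \<circ> p) j)))
      = (\<Sum>p | p permutes {1..n}. indicator A (\<lambda>j\<in>{1..n}. y (p j)) :: real)"
      by (rule setum_permutations_compose_left[OF q(1), symmetric])
    also have "\<dots> / fact n = (\<integral>z. indicator A z \<partial>lambda_Nk M n n y)"
      using A y by (subst integral_lambda_Nk) auto
    also have "\<dots> = measure (lambda_Nk M n n y) A" using A by simp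
    finally show "emeasure (lambda_Nk M n n x) A = emeasure (lambda_Nk M n n y) A"
      using prob_space_lambda_Nk[OF x] prob_space_lambda_Nk[OF y]
      by (simp add: finite_measure.emeasure_eq_measure prob_space.finite_measure)
  qed simp
qed

section \<open>Measurable dependence on the empirical measure\<close>

lemma prob_algebraD:
  assumes "\<mu> \<in> space (prob_algebra M)"
  shows "prob_space \<mu>" "sets \<mu> = sets M" "space \<mu> = space M"
  using assms by (auto simp: space_prob_algebra dest: sets_eq_imp_space_eq)

text \<open>On a generating cylinder the product measure is a finite product of measurable factors,
  even if \<open>I\<close> is infinite. The lemma serves the i.i.d. kernel of an infinite class, the
  sample behind \<open>cond_sample\<close>, and the product over classes.\<close>

lemma measurable_PiM_prob_algebra:
  assumes K: "\<And>i. i \<in> I \<Longrightarrow> K i \<in> L \<rightarrow>\<^sub>M prob_algebra (M i)"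
  shows "(\<lambda>\<omega>. PiM I (\<lambda>i. K i \<omega>)) \<in> L \<rightarrow>\<^sub>M prob_algebra (PiM I M)"
proof (rule measurable_prob_algebra_generated[OF sets_PiM Int_stable_prod_algebra prod_algebra_sets_into_space])
  fix \<omega> assume "\<omega> \<in> space L"
  then have \<omega>: "K i \<omega> \<in> space (prob_algebra (M i))" if "i \<in> I" for i
    using measurable_space[OF K[OF that]] by simp
  show "prob_space (PiM I (\<lambda>i. K i \<omega>))"
    using prob_algebraD(1)[OF \<omega>] by (intro prob_space_PiM)
  show "sets (PiM I (\<lambda>i. K i \<omega>)) = sets (PiM I M)"
    using prob_algebraD(2)[OF \<omega>] by (intro sets_PiM_cong) auto
next
  fix A assume "A \<in> prod_algebra I M"
  then obtain J E where A: "A = prod_emb I M J (\<Pi>\<^sub>E j\<in>J. E j)" and J: "finite J" "J \<subseteq> I"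
    and E: "\<And>i. i \<in> J \<Longrightarrow> E i \<in> sets (M i)"
    by (rule prod_algebraE) blast
  have "emeasure (PiM I (\<lambda>i. K i \<omega>)) A = (\<Prod>j\<in>J. emeasure (K j \<omega>) (E j))" if "\<omega> \<in> space L" for \<omega>
  proof -
    have \<omega>: "K i \<omega> \<in> space (prob_algebra (M i))" if "i \<in> I" for i
      using measurable_space[OF K[OF that] \<open>\<omega> \<in> space L\<close>] .
    have "A = prod_emb I (\<lambda>i. K i \<omega>) J (\<Pi>\<^sub>E j\<in>J. E j)"
      unfolding A prod_emb_def using prob_algebraD(3)[OF \<omega>] by (auto simp: PiE_iff)
    then show ?thesis
      using prob_algebraD(1,2)[OF \<omega>] J E by (auto intro!: emeasure_PiM_emb)
  qed
  moreover have "(\<lambda>\<omega>. \<Prod>j\<in>J. emeasure (K j \<omega>) (E j)) \<in> borel_measurable L"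
    using J E by (intro borel_measurable_prod_ennreal
        measurable_compose[OF measurable_prob_algebraD[OF K] measurable_emeasure_subprob_algebra]) auto
  ultimately show "(\<lambda>\<omega>. emeasure (PiM I (\<lambda>i. K i \<omega>)) A) \<in> borel_measurable L"
    by (simp cong: measurable_cong)
qed

lemma emeasure_PiM_PiE:
  assumes "finite I" "\<And>i. i \<in> I \<Longrightarrow> prob_space (M i)" "\<And>i. i \<in> I \<Longrightarrow> A i \<in> sets (M i)"
  shows "emeasure (PiM I M) (Pi\<^sub>E I A) = (\<Prod>i\<in>I. emeasure (M i) (A i))"
proof -
  have "prod_emb I M I (Pi\<^sub>E I A) = Pi\<^sub>E I A"
    using sets.sets_into_space[OF assms(3)] by (intro prod_emb_PiE_same_index) auto
  then show ?thesis
    using emeasure_PiM_emb[of I M I A] assms by simp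
qed

lemma empirical_cong:
  "(\<And>k. k \<in> {1..n} \<Longrightarrow> x k = y k) \<Longrightarrow> empirical M n x = empirical M n y"
proof -
  assume "\<And>k. k \<in> {1..n} \<Longrightarrow> x k = y k"
  then have "{k \<in> {1..n}. x k \<in> A} = {k \<in> {1..n}. y k \<in> A}" for A by auto
  then show ?thesis unfolding empirical_def by (simp only:)
qed

lemma empirical_permute:
  assumes p: "p permutes {1..n}"
  shows "empirical M n (\<lambda>k. x (p k)) = empirical M n x"
proof -
  have "card {k \<in> {1..n}. x (p k) \<in> A} = card {k \<in> {1..n}. x k \<in> A}" for A
  proof -
    have "p ` {k \<in> {1..n}. x (p k) \<in> A} = {k \<in> {1..n}. x k \<in> A}"
    proof (intro set_eqI iffI)
      fix k assume "k \<in> {k \<in> {1..n}. x k \<in> A}"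
      then show "k \<in> p ` {k \<in> {1..n}. x (p k) \<in> A}"
        using permutes_inverses(1)[OF p, of k] permutes_in_image[OF permutes_inv[OF p], of k]
        by (intro image_eqI[of _ _ "inv p k"]) auto
    qed (use permutes_in_image[OF p] in fastforce)
    then show ?thesis
      using card_image[OF permutes_inj_on[OF p], of "{k \<in> {1..n}. x (p k) \<in> A}"] by simp
  qed
  then show ?thesis unfolding empirical_def by (simp only:)
qed

text \<open>An \<open>n\<close>-sample from \<open>\<mu>\<close> conditioned on having empirical measure \<open>\<mu>\<close>. This is defined for every
  probability measure \<open>\<mu>\<close>, so measurability in \<open>\<mu>\<close> needs no measurable choice of atoms.\<close>
definition cond_sample :: "'a measure \<Rightarrow> nat \<Rightarrow> 'a measure \<Rightarrow> (nat \<Rightarrow> 'a) measure" where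
  "cond_sample M n \<mu> = (let P = PiM {1..n} (\<lambda>_. \<mu>); D = {y \<in> space (PiM {1..n} (\<lambda>_. M)). empirical M n y = \<mu>}
     in if emeasure P D = 0 then P else uniform_measure P D)"

lemma empirical_eq_iff_generator:
  assumes n: "n \<ge> 1" and gen: "Int_stable \<A>" "\<A> \<subseteq> Pow (space M)" "space M \<in> \<A>" "sets M = sigma_sets (space M) \<A>"
    and \<mu>: "\<mu> \<in> space (prob_algebra M)" and y: "y \<in> {1..n} \<rightarrow> space M"
  shows "empirical M n y = \<mu> \<longleftrightarrow> (\<forall>B\<in>\<A>. measure (empirical M n y) B = measure \<mu> B)"
proof (intro iffI, blast)
  assume eq: "\<forall>B\<in>\<A>. measure (empirical M n y) B = measure \<mu> B"
  interpret E: prob_space "empirical M n y" by (rule prob_space_empirical[OF n y])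
  interpret U: prob_space \<mu> by (rule prob_algebraD[OF \<mu>])
  show "empirical M n y = \<mu>"
    using eq gen prob_algebraD(2)[OF \<mu>]
    by (intro measure_eqI_generator_eq[OF gen(1,2), where A = "\<lambda>_. space M"])
      (auto simp: E.emeasure_eq_measure U.emeasure_eq_measure)
qed

text \<open>By the generator, a pair lies in the graph iff countably many equations hold between
  measurable functions of \<open>\<mu>\<close> and of the sample \<open>y\<close>.\<close>

lemma sets_empirical_graph:
  fixes M :: "'a measure"
  assumes n: "n \<ge> 1" and gen: "countable \<A>" "Int_stable \<A>" "\<A> \<subseteq> Pow (space M)" "space M \<in> \<A>"
    "sets M = sigma_sets (space M) \<A>"
  shows "(SIGMA \<mu>:space (prob_algebra M). {y \<in> space (PiM {1..n} (\<lambda>_. M)). empirical M n y = \<mu>})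
    \<in> sets (prob_algebra M \<Otimes>\<^sub>M PiM {1..n} (\<lambda>_. M))"
proof -
  let ?PM = "PiM {1..n} (\<lambda>_. M)"
  define D where "D \<mu> = {y \<in> space ?PM. empirical M n y = \<mu>}" for \<mu>
  have inA: "B \<in> sets M" if "B \<in> \<A>" for B using that gen(5) by auto
  have sp: "y \<in> {1..n} \<rightarrow> space M" if "y \<in> space ?PM" for y
    using that by (auto simp: space_PiM)
  have Sig: "Sigma (space (prob_algebra M)) D \<in> sets (prob_algebra M \<Otimes>\<^sub>M ?PM)"
  proof -
    let ?N = "prob_algebra M \<Otimes>\<^sub>M ?PM"
    have "Sigma (space (prob_algebra M)) D =
      {w \<in> space ?N. \<forall>B\<in>\<A>. (\<Sum>k\<in>{1..n}. indicator B (snd w k)) / real n = measure (fst w) B}"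
      (is "_ = ?R")
    proof -
      have "empirical M n y = \<mu> \<longleftrightarrow> (\<forall>B\<in>\<A>. (\<Sum>k\<in>{1..n}. indicator B (y k)) / real n = measure \<mu> B)"
        if "\<mu> \<in> space (prob_algebra M)" "y \<in> space ?PM" for \<mu> y
      proof -
        have "(\<Sum>k\<in>{1..n}. indicator B (y k)) = real (card {k \<in> {1..n}. y k \<in> B})" for B
        proof -
          have "(\<Sum>k\<in>{1..n}. indicator B (y k) :: real) = (\<Sum>k | k \<in> {1..n} \<and> y k \<in> B. 1)"
            by (rule sum.mono_neutral_cong_right) (auto simp: indicator_def)
          then show ?thesis by simp
        qed
        then show ?thesis
          unfolding empirical_eq_iff_generator[OF n gen(2-5) that(1) sp[OF that(2)]]
          using measure_empirical[OF n sp[OF that(2)] inA] by simp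
      qed
      then show ?thesis
        by (auto simp: D_def space_pair_measure)
    qed
    also have "?R \<in> sets ?N"
    proof (rule sets.sets_Collect_countable_All')
      fix B assume "B \<in> \<A>"
      then have B[measurable]: "B \<in> sets M" by (rule inA)
      have [measurable]: "(\<lambda>w. measure (fst w) B) \<in> borel_measurable ?N"
        by (rule measurable_compose[OF measurable_fst
              measurable_compose[OF measurable_prob_algebraD[OF measurable_ident] measurable_measure_subprob_algebra[OF B], unfolded id_def]])
      have [measurable]: "(\<lambda>w. indicator B (snd w k) :: real) \<in> borel_measurable ?N" if "k \<in> {1..n}" for k
        by (rule measurable_compose[OF measurable_snd
              measurable_compose[OF measurable_component_singleton[OF that] borel_measurable_indicator[OF B]]])
      show "{w \<in> space ?N. (\<Sum>k\<in>{1..n}. indicator B (snd w k)) / real n = measure (fst w) B} \<in> sets ?N"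
        by measurable
    qed (use gen in simp)
    finally show ?thesis .
  qed
  then show ?thesis unfolding D_def .
qed

text \<open>Joint measurability of the graph makes the probabilities of \<open>D \<mu>\<close> and
  of \<open>D \<mu> \<inter> A\<close> measurable in \<open>\<mu>\<close>, hence also their
  quotient. Where the conditioning event is null, the default \<open>P \<mu>\<close> keeps the value
  a probability measure.\<close>

lemma measurable_cond_sample:
  fixes M :: "'a measure"
  assumes n: "n \<ge> 1" and gen: "countable \<A>" "Int_stable \<A>" "\<A> \<subseteq> Pow (space M)" "space M \<in> \<A>"
    "sets M = sigma_sets (space M) \<A>"
  shows "cond_sample M n \<in> prob_algebra M \<rightarrow>\<^sub>M prob_algebra (PiM {1..n} (\<lambda>_. M))"
proof -
  let ?PM = "PiM {1..n} (\<lambda>_. M)"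
  define P where "P \<mu> = PiM {1..n} (\<lambda>_::nat. \<mu>)" for \<mu> :: "'a measure"
  define D where "D \<mu> = {y \<in> space ?PM. empirical M n y = \<mu>}" for \<mu>
  have P: "P \<in> prob_algebra M \<rightarrow>\<^sub>M prob_algebra ?PM"
    unfolding P_def by (rule measurable_PiM_prob_algebra) simp
  have Sig: "Sigma (space (prob_algebra M)) D \<in> sets (prob_algebra M \<Otimes>\<^sub>M ?PM)"
    unfolding D_def by (rule sets_empirical_graph[OF n gen])
  have Dset: "D \<mu> \<in> sets ?PM" if "\<mu> \<in> space (prob_algebra M)" for \<mu>
    using sets_Pair1[OF Sig, of \<mu>] that by (simp add: vimage_def)
  have cs: "cond_sample M n \<mu> = (if emeasure (P \<mu>) (D \<mu>) = 0 then P \<mu> else uniform_measure (P \<mu>) (D \<mu>))" for \<mu>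
    by (simp add: cond_sample_def P_def D_def Let_def)
  have pr: "prob_space (P \<mu>)" "sets (P \<mu>) = sets ?PM" if "\<mu> \<in> space (prob_algebra M)" for \<mu>
    using prob_algebraD[OF measurable_space[OF P that]] by auto
  show ?thesis
  proof (rule measurable_prob_algebra_generated[OF sets.sigma_sets_eq[symmetric] sets.Int_stable sets.space_closed])
    fix \<mu> assume \<mu>: "\<mu> \<in> space (prob_algebra M)"
    interpret prob_space "P \<mu>" using pr[OF \<mu>] by simp
    show "prob_space (cond_sample M n \<mu>)"
      by (auto simp: cs intro: prob_space_axioms prob_space_uniform_measure)
    show "sets (cond_sample M n \<mu>) = sets ?PM"
      using pr[OF \<mu>] by (simp add: cs)
  next
    fix A assume A: "A \<in> sets ?PM"
    have SigA: "(SIGMA \<mu>:space (prob_algebra M). D \<mu> \<inter> A) \<in> sets (prob_algebra M \<Otimes>\<^sub>M ?PM)"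
    proof -
      have "(SIGMA \<mu>:space (prob_algebra M). D \<mu> \<inter> A) =
        Sigma (space (prob_algebra M)) D \<inter> (space (prob_algebra M) \<times> A)" by auto
      then show ?thesis using Sig A by simp
    qed
    note P' = measurable_prob_algebraD[OF P]
    have "(\<lambda>\<mu>. if emeasure (P \<mu>) (D \<mu>) = 0 then emeasure (P \<mu>) A
        else emeasure (P \<mu>) (D \<mu> \<inter> A) / emeasure (P \<mu>) (D \<mu>)) \<in> borel_measurable (prob_algebra M)"
      using emeasure_measurable_subprob_algebra2[OF Sig P'] emeasure_measurable_subprob_algebra2[OF SigA P']
        measurable_compose[OF P' measurable_emeasure_subprob_algebra[OF A]]
      by measurable
    then show "(\<lambda>\<mu>. emeasure (cond_sample M n \<mu>) A) \<in> borel_measurable (prob_algebra M)"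
      by (rule measurable_cong[THEN iffD1, rotated])
        (use A pr Dset in \<open>auto simp: cs\<close>)
  qed
qed

text \<open>Permuting coordinates preserves both the i.i.d. law and the event of having a prescribed
  empirical measure. Conditionally on that event, every ordering of the fixed multiset of values is
  therefore equally likely.\<close>

lemma cond_sample_empirical:
  fixes M :: "'a measure"
  assumes n: "n \<ge> 1" and x: "x \<in> {1..n} \<rightarrow> space M"
    and single: "\<And>v. v \<in> space M \<Longrightarrow> {v} \<in> sets M"
    and gen: "countable \<A>" "Int_stable \<A>" "\<A> \<subseteq> Pow (space M)" "space M \<in> \<A>"
    "sets M = sigma_sets (space M) \<A>"
  shows "cond_sample M n (empirical M n x) = lambda_Nk M n n x"
proof -
  let ?PM = "PiM {1..n} (\<lambda>_. M)"
  define \<mu> where "\<mu> = empirical M n x"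
  define P where "P = PiM {1..n} (\<lambda>_::nat. \<mu>)"
  define D where "D = {y \<in> space ?PM. empirical M n y = \<mu>}"
  have "\<mu> \<in> space (prob_algebra M)"
    using prob_space_empirical[OF n x] by (simp add: \<mu>_def space_prob_algebra)
  then have D: "D \<in> sets ?PM"
    using sets_Pair1[OF sets_empirical_graph[OF n gen], of \<mu>] by (simp add: D_def vimage_def)
  interpret \<mu>: prob_space \<mu> unfolding \<mu>_def by (rule prob_space_empirical[OF n x])
  have sets_\<mu>: "sets \<mu> = sets M" and space_\<mu>: "space \<mu> = space M" by (simp_all add: \<mu>_def)
  interpret P: prob_space P unfolding P_def by (rule prob_space_PiM) (rule \<mu>.prob_space_axioms)
  have sets_P[measurable_cong]: "sets P = sets ?PM"
    unfolding P_def by (intro sets_PiM_cong) (auto simp: sets_\<mu>)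
  have space_P: "space P = space ?PM" by (rule sets_eq_imp_space_eq[OF sets_P])
  \<comment> \<open>The event contains the single ordered sample \<open>x\<close>, and every
    \<open>x k\<close> is an atom of \<open>\<mu>\<close> of mass at least
    \<open>1 / n\<close>.\<close>
  have pos: "emeasure P D \<noteq> 0"
  proof -
    have "restrict x {1..n} \<in> D"
      using x by (auto simp: D_def \<mu>_def space_PiM intro!: empirical_cong)
    moreover have "Pi\<^sub>E {1..n} (\<lambda>k. {x k}) = Pi\<^sub>E {1..n} (\<lambda>k. {restrict x {1..n} k})"
      by (rule PiE_cong) simp
    ultimately have "Pi\<^sub>E {1..n} (\<lambda>k. {x k}) \<subseteq> D"
      by (simp only: PiE_singleton[OF restrict_extensional]) blast
    moreover have "emeasure P (Pi\<^sub>E {1..n} (\<lambda>k. {x k})) = (\<Prod>k\<in>{1..n}. emeasure \<mu> {x k})"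
      unfolding P_def using x by (intro emeasure_PiM_PiE \<mu>.prob_space_axioms) (auto simp: sets_\<mu> Pi_iff intro!: single)
    moreover have "emeasure \<mu> {x k} \<noteq> 0" if "k \<in> {1..n}" for k
    proof -
      have "{x k} \<in> sets M" using x that by (intro single) auto
      then have "measure \<mu> {x k} = real (card {j \<in> {1..n}. x j \<in> {x k}}) / real n"
        unfolding \<mu>_def by (rule measure_empirical[OF n x])
      moreover have "card {j \<in> {1..n}. x j \<in> {x k}} \<noteq> 0"
        using that by (subst card_eq_0_iff) auto
      ultimately show ?thesis using n by (simp add: \<mu>.emeasure_eq_measure)
    qed
    ultimately show ?thesis
      using emeasure_mono[of "Pi\<^sub>E {1..n} (\<lambda>k. {x k})" D P] D sets_P by (auto simp: prod_zero_iff)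
  qed
  \<comment> \<open>The left side is replaced by its average over all permutations of the
    coordinates. For a sample \<open>y\<close> in \<open>D\<close> the averaged indicator of
    \<open>A\<close> is the mass of \<open>A\<close> under the draw from \<open>y\<close>, and this
    draw has the same law as the draw from \<open>x\<close>.\<close>
  have key: "measure P (D \<inter> A) = measure P D * measure (lambda_Nk M n n x) A" if A: "A \<in> sets ?PM" for A
  proof -
    let ?T = "\<lambda>p y. \<lambda>j\<in>{1..n}. y (p j)"
    let ?S = "{p. p permutes {1..n}}"
    have T: "?T p \<in> ?PM \<rightarrow>\<^sub>M ?PM" if "p permutes {1..n}" for p
      using permutes_in_image[OF that]
      by (intro measurable_restrict measurable_component_singleton) auto
    have inv: "(\<integral>y. indicator D y * indicator A (?T p y) \<partial>P) = measure P (D \<inter> A)" if p: "p permutes {1..n}" for p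
    proof -
      have TP: "?T p \<in> P \<rightarrow>\<^sub>M P" using T[OF p] by (simp add: sets_P cong: measurable_cong_sets)
      have dP: "distr P P (?T p) = P"
        unfolding P_def
        by (rule distr_PiM_reindex) (use \<mu>.prob_space_axioms permutes_inj_on[OF p] permutes_in_image[OF p] in auto)
      have TD: "?T p y \<in> D \<longleftrightarrow> y \<in> D" if "y \<in> space P" for y
      proof -
        have "empirical M n (?T p y) = empirical M n (\<lambda>k. y (p k))"
          by (rule empirical_cong) simp
        then show ?thesis
          using that measurable_space[OF TP that] empirical_permute[OF p, of M y] by (auto simp: D_def space_P)
      qed
      have "measure P (D \<inter> A) = (\<integral>y. indicator (D \<inter> A) y \<partial>distr P P (?T p))"
        using D A by (simp add: dP sets_P)
      also have "\<dots> = (\<integral>y. indicator (D \<inter> A) (?T p y) \<partial>P)"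
        using TP D A by (intro integral_distr) (auto simp: sets_P)
      also have "\<dots> = (\<integral>y. indicator D y * indicator A (?T p y) \<partial>P)"
        using TD by (intro Bochner_Integration.integral_cong refl) (auto simp: indicator_def)
      finally show ?thesis by simp
    qed
    have "fact n * measure P (D \<inter> A) = (\<Sum>p\<in>?S. \<integral>y. indicator D y * indicator A (?T p y) \<partial>P)"
      by (simp add: inv card_permutations)
    also have "\<dots> = (\<integral>y. (\<Sum>p\<in>?S. indicator D y * indicator A (?T p y)) \<partial>P)"
    proof (rule Bochner_Integration.integral_sum[symmetric])
      fix p assume "p \<in> ?S"
      then have [measurable]: "?T p \<in> P \<rightarrow>\<^sub>M ?PM" using T by (simp add: sets_P cong: measurable_cong_sets)
      show "integrable P (\<lambda>y. indicator D y * indicator A (?T p y) :: real)"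
        using D A by (intro P.integrable_const_bound[where B = 1]) (auto simp: indicator_def)
    qed
    also have "\<dots> = (\<integral>y. indicator D y * (fact n * measure (lambda_Nk M n n x) A) \<partial>P)"
    proof (intro Bochner_Integration.integral_cong refl)
      fix y assume y: "y \<in> space P"
      show "(\<Sum>p\<in>?S. indicator D y * indicator A (?T p y)) =
        (indicator D y * (fact n * measure (lambda_Nk M n n x) A) :: real)"
      proof (cases "y \<in> D")
        case True
        have y': "y \<in> {1..n} \<rightarrow> space M" using y by (auto simp: space_P space_PiM)
        have "lambda_Nk M n n x = lambda_Nk M n n y"
          using True by (intro lambda_Nk_eq_of_empirical_eq n x y' single) (auto simp: D_def \<mu>_def)
        then have "measure (lambda_Nk M n n x) A = (\<integral>z. indicator A z \<partial>lambda_Nk M n n y)"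
          using A by simp
        also have "\<dots> = (\<Sum>p\<in>?S. indicator A (?T p y)) / fact n"
          using A by (intro integral_lambda_Nk[OF y']) simp
        finally show ?thesis using True by simp
      qed simp
    qed
    also have "\<dots> = fact n * (measure P D * measure (lambda_Nk M n n x) A)"
      using D by (simp add: sets_P)
    finally show ?thesis by simp
  qed
  interpret L: prob_space "lambda_Nk M n n x" by (rule prob_space_lambda_Nk[OF x])
  have "uniform_measure P D = lambda_Nk M n n x"
  proof (rule measure_eqI)
    fix A assume "A \<in> sets (uniform_measure P D)"
    then have A: "A \<in> sets ?PM" by (simp add: sets_P)
    have "measure P D > 0" using pos by (simp add: P.emeasure_eq_measure zero_less_measure_iff)
    then show "emeasure (uniform_measure P D) A = emeasure (lambda_Nk M n n x) A"
      using A D key[OF A] by (simp add: sets_P P.emeasure_eq_measure L.emeasure_eq_measure divide_ennreal)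
  qed (simp add: sets_P)
  then show ?thesis
    using pos unfolding cond_sample_def Let_def \<mu>_def[symmetric] P_def[symmetric] D_def[symmetric] by simp
qed

section \<open>Events determined by either of two coupled variables\<close>

text \<open>Events that, up to null sets, are given by one and the same measurable condition on \<open>Y\<close> and on \<open>Z\<close>.
  This replaces the sigma-algebra of permutation invariant events, and needs no
  everywhere defined version of the directing measure.\<close>
definition coupled :: "'w measure \<Rightarrow> 'b measure \<Rightarrow> ('w \<Rightarrow> 'b) \<Rightarrow> ('w \<Rightarrow> 'b) \<Rightarrow> 'w measure" where
  "coupled M P Y Z = sigma (space M)
     {E \<in> sets M. \<exists>D\<in>sets P. AE \<omega> in M. (\<omega> \<in> E \<longleftrightarrow> Y \<omega> \<in> D) \<and> (\<omega> \<in> E \<longleftrightarrow> Z \<omega> \<in> D)}"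

lemma space_coupled [simp]: "space (coupled M P Y Z) = space M"
  unfolding coupled_def by (rule space_measure_of) (auto dest: sets.sets_into_space)

text \<open>The generating family is already a sigma-algebra: countably many exceptional null sets
  unite to one, and the witnesses \<open>D\<close> undergo the same set operations as the
  events.\<close>

lemma sets_coupled:
  assumes Y: "Y \<in> M \<rightarrow>\<^sub>M P" and Z: "Z \<in> M \<rightarrow>\<^sub>M P"
  shows "sets (coupled M P Y Z) =
     {E \<in> sets M. \<exists>D\<in>sets P. AE \<omega> in M. (\<omega> \<in> E \<longleftrightarrow> Y \<omega> \<in> D) \<and> (\<omega> \<in> E \<longleftrightarrow> Z \<omega> \<in> D)}"
    (is "_ = ?D")
proof -
  have sub: "?D \<subseteq> Pow (space M)" by (auto dest: sets.sets_into_space)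
  have "sigma_algebra (space M) ?D"
  proof (rule sigma_algebra_iff2[THEN iffD2], intro conjI ballI allI impI)
    show "?D \<subseteq> Pow (space M)" by (rule sub)
    have "AE \<omega> in M. (\<omega> \<in> {} \<longleftrightarrow> Y \<omega> \<in> {}) \<and> (\<omega> \<in> {} \<longleftrightarrow> Z \<omega> \<in> {})" by simp
    then show "{} \<in> ?D" using sets.empty_sets[of P] sets.empty_sets[of M] by blast
  next
    fix E assume "E \<in> ?D"
    then obtain D where E: "E \<in> sets M" and D: "D \<in> sets P"
      and ae: "AE \<omega> in M. (\<omega> \<in> E \<longleftrightarrow> Y \<omega> \<in> D) \<and> (\<omega> \<in> E \<longleftrightarrow> Z \<omega> \<in> D)"
      by blast
    have "AE \<omega> in M. (\<omega> \<in> space M - E \<longleftrightarrow> Y \<omega> \<in> space P - D) \<and> (\<omega> \<in> space M - E \<longleftrightarrow> Z \<omega> \<in> space P - D)"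
      using ae AE_space by eventually_elim (auto dest: measurable_space[OF Y] measurable_space[OF Z])
    then show "space M - E \<in> ?D"
      using sets.compl_sets[OF E] sets.compl_sets[OF D] by blast
  next
    fix E :: "nat \<Rightarrow> 'a set" assume "range E \<subseteq> ?D"
    then have ED: "E n \<in> ?D" for n by (rule subsetD) (rule rangeI)
    then have E: "\<And>n. E n \<in> sets M" by simp
    have "\<forall>n. \<exists>D. D \<in> sets P \<and> (AE \<omega> in M. (\<omega> \<in> E n \<longleftrightarrow> Y \<omega> \<in> D) \<and> (\<omega> \<in> E n \<longleftrightarrow> Z \<omega> \<in> D))"
      using ED by (simp add: Bex_def)
    from choice[OF this] obtain D where D: "\<And>n. D n \<in> sets P"
      and ae: "\<And>n. AE \<omega> in M. (\<omega> \<in> E n \<longleftrightarrow> Y \<omega> \<in> D n) \<and> (\<omega> \<in> E n \<longleftrightarrow> Z \<omega> \<in> D n)"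
      by blast
    have "AE \<omega> in M. \<forall>n. (\<omega> \<in> E n \<longleftrightarrow> Y \<omega> \<in> D n) \<and> (\<omega> \<in> E n \<longleftrightarrow> Z \<omega> \<in> D n)"
      unfolding AE_all_countable by (intro allI ae)
    then have "AE \<omega> in M. (\<omega> \<in> (\<Union>n. E n) \<longleftrightarrow> Y \<omega> \<in> (\<Union>n. D n)) \<and> (\<omega> \<in> (\<Union>n. E n) \<longleftrightarrow> Z \<omega> \<in> (\<Union>n. D n))"
      by eventually_elim blast
    moreover have "(\<Union>n. E n) \<in> sets M" "(\<Union>n. D n) \<in> sets P" using E D by auto
    ultimately show "(\<Union>n. E n) \<in> ?D" by blast
  qed
  then show ?thesis
    unfolding coupled_def using sub by (simp add: sigma_algebra.sigma_sets_eq)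
qed

text \<open>One witness, the preimage of \<open>A\<close> under \<open>\<phi>\<close>, describes the
  event through \<open>Y\<close> and through \<open>Z\<close> alike.\<close>

lemma measurable_coupledI:
  assumes Y: "Y \<in> M \<rightarrow>\<^sub>M P" and Z: "Z \<in> M \<rightarrow>\<^sub>M P" and r: "r \<in> M \<rightarrow>\<^sub>M R" and \<phi>: "\<phi> \<in> P \<rightarrow>\<^sub>M R"
    and "AE \<omega> in M. r \<omega> = \<phi> (Y \<omega>)" "AE \<omega> in M. r \<omega> = \<phi> (Z \<omega>)"
  shows "r \<in> coupled M P Y Z \<rightarrow>\<^sub>M R"
proof (rule measurableI)
  show "r \<omega> \<in> space R" if "\<omega> \<in> space (coupled M P Y Z)" for \<omega>
    using measurable_space[OF r] that by simp
  fix A assume A: "A \<in> sets R"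
  have "AE \<omega> in M. (\<omega> \<in> r -` A \<inter> space M \<longleftrightarrow> Y \<omega> \<in> \<phi> -` A \<inter> space P) \<and>
      (\<omega> \<in> r -` A \<inter> space M \<longleftrightarrow> Z \<omega> \<in> \<phi> -` A \<inter> space P)"
    using assms(5,6) AE_space
    by eventually_elim (auto dest: measurable_space[OF Y] measurable_space[OF Z])
  then show "r -` A \<inter> space (coupled M P Y Z) \<in> sets (coupled M P Y Z)"
    unfolding sets_coupled[OF Y Z] space_coupled using measurable_sets[OF r A] measurable_sets[OF \<phi> A]
    by blast
qed

lemma measurable_coupledD:
  assumes "Y \<in> M \<rightarrow>\<^sub>M P" "Z \<in> M \<rightarrow>\<^sub>M P" "r \<in> coupled M P Y Z \<rightarrow>\<^sub>M R"
  shows "r \<in> M \<rightarrow>\<^sub>M R"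
  using assms(3) unfolding measurable_def by (auto simp: sets_coupled[OF assms(1,2)])

text \<open>Up to a null set, \<open>E\<close> is the event that the variable falls into
  \<open>D\<close>, so both sides are the common law evaluated at
  \<open>A \<inter> D\<close>.\<close>

lemma emeasure_coupled_eq:
  assumes Y: "Y \<in> M \<rightarrow>\<^sub>M P" and Z: "Z \<in> M \<rightarrow>\<^sub>M P" and dist: "distr M P Y = distr M P Z"
    and E: "E \<in> sets (coupled M P Y Z)" and A: "A \<in> sets P"
  shows "emeasure M {\<omega> \<in> space M. Y \<omega> \<in> A \<and> \<omega> \<in> E} = emeasure M {\<omega> \<in> space M. Z \<omega> \<in> A \<and> \<omega> \<in> E}"
proof -
  from E obtain D where EM: "E \<in> sets M" and D: "D \<in> sets P"
    and ae: "AE \<omega> in M. (\<omega> \<in> E \<longleftrightarrow> Y \<omega> \<in> D) \<and> (\<omega> \<in> E \<longleftrightarrow> Z \<omega> \<in> D)"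
    unfolding sets_coupled[OF Y Z] by blast
  have *: "emeasure M {\<omega> \<in> space M. U \<omega> \<in> A \<and> \<omega> \<in> E} = emeasure (distr M P U) (A \<inter> D)"
    if U: "U \<in> M \<rightarrow>\<^sub>M P" and "AE \<omega> in M. \<omega> \<in> E \<longleftrightarrow> U \<omega> \<in> D" for U
  proof -
    have "emeasure M {\<omega> \<in> space M. U \<omega> \<in> A \<and> \<omega> \<in> E} = emeasure M (U -` (A \<inter> D) \<inter> space M)"
    proof (rule emeasure_eq_AE)
      show "AE \<omega> in M. (\<omega> \<in> {\<omega> \<in> space M. U \<omega> \<in> A \<and> \<omega> \<in> E}) = (\<omega> \<in> U -` (A \<inter> D) \<inter> space M)"
        using that(2) by eventually_elim auto
      have "{\<omega> \<in> space M. U \<omega> \<in> A \<and> \<omega> \<in> E} = (U -` A \<inter> space M) \<inter> E" by auto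
      then show "{\<omega> \<in> space M. U \<omega> \<in> A \<and> \<omega> \<in> E} \<in> sets M"
        using measurable_sets[OF U A] EM by simp
      show "U -` (A \<inter> D) \<inter> space M \<in> sets M"
        using A D by (intro measurable_sets[OF U]) simp
    qed
    also have "\<dots> = emeasure (distr M P U) (A \<inter> D)"
      using A D by (intro emeasure_distr[OF U, symmetric]) simp
    finally show ?thesis .
  qed
  show ?thesis
    using *[OF Y] *[OF Z] ae dist by auto
qed

lemma emeasure_distr_density_indicator:
  assumes U: "U \<in> M \<rightarrow>\<^sub>M P" and EM: "E \<in> sets M" and A: "A \<in> sets P"
  shows "emeasure (distr (density M (\<lambda>\<omega>. ennreal (indicator E \<omega>))) P U) A
    = emeasure M {\<omega> \<in> space M. U \<omega> \<in> A \<and> \<omega> \<in> E}"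
proof -
  let ?M = "density M (\<lambda>\<omega>. ennreal (indicator E \<omega>))"
  have UA: "U -` A \<inter> space M \<in> sets M" by (rule measurable_sets[OF U A])
  have "emeasure (distr ?M P U) A = emeasure ?M (U -` A \<inter> space M)"
    using U A by (subst emeasure_distr) (simp_all cong: measurable_cong_sets)
  also have "\<dots> = (\<integral>\<^sup>+\<omega>. ennreal (indicator E \<omega>) * indicator (U -` A \<inter> space M) \<omega> \<partial>M)"
    using EM UA by (intro emeasure_density) auto
  also have "\<dots> = (\<integral>\<^sup>+\<omega>. indicator {\<omega> \<in> space M. U \<omega> \<in> A \<and> \<omega> \<in> E} \<omega> \<partial>M)"
    by (intro nn_integral_cong) (auto simp: indicator_def)
  also have "\<dots> = emeasure M {\<omega> \<in> space M. U \<omega> \<in> A \<and> \<omega> \<in> E}"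
  proof (rule nn_integral_indicator)
    have "{\<omega> \<in> space M. U \<omega> \<in> A \<and> \<omega> \<in> E} = (U -` A \<inter> space M) \<inter> E" by auto
    then show "{\<omega> \<in> space M. U \<omega> \<in> A \<and> \<omega> \<in> E} \<in> sets M" using UA EM by simp
  qed
  finally show ?thesis .
qed

text \<open>The two variables have the same law under the measure weighted by the indicator of
  \<open>E\<close>. The weight is not normalised, so \<open>E\<close> may be null.\<close>

lemma integral_coupled_eq:
  fixes H :: "'b \<Rightarrow> real"
  assumes Y: "Y \<in> M \<rightarrow>\<^sub>M P" and Z: "Z \<in> M \<rightarrow>\<^sub>M P" and dist: "distr M P Y = distr M P Z"
    and E: "E \<in> sets (coupled M P Y Z)" and H: "H \<in> borel_measurable P"
  shows "(\<integral>\<omega>. indicator E \<omega> * H (Y \<omega>) \<partial>M) = (\<integral>\<omega>. indicator E \<omega> * H (Z \<omega>) \<partial>M)"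
proof -
  have EM: "E \<in> sets M" using E unfolding sets_coupled[OF Y Z] by blast
  let ?M = "density M (\<lambda>\<omega>. ennreal (indicator E \<omega>))"
  have *: "(\<integral>\<omega>. indicator E \<omega> * H (U \<omega>) \<partial>M) = (\<integral>y. H y \<partial>distr ?M P U)" if U: "U \<in> M \<rightarrow>\<^sub>M P" for U
  proof -
    have "(\<integral>y. H y \<partial>distr ?M P U) = (\<integral>\<omega>. H (U \<omega>) \<partial>?M)"
      using U H by (intro integral_distr) (simp_all cong: measurable_cong_sets)
    also have "\<dots> = (\<integral>\<omega>. indicator E \<omega> *\<^sub>R H (U \<omega>) \<partial>M)"
      using EM by (intro integral_density measurable_compose[OF U H]) auto
    finally show ?thesis by simp
  qed
  have "distr ?M P Y = distr ?M P Z"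
  proof (rule measure_eqI)
    fix A assume "A \<in> sets (distr ?M P Y)"
    then have A: "A \<in> sets P" by simp
    show "emeasure (distr ?M P Y) A = emeasure (distr ?M P Z) A"
      unfolding emeasure_distr_density_indicator[OF Y EM A] emeasure_distr_density_indicator[OF Z EM A]
      by (rule emeasure_coupled_eq[OF Y Z dist E A])
  qed simp
  then show ?thesis using *[OF Y] *[OF Z] by simp
qed

section \<open>Permutation invariance of the measure vector\<close>

lemma idx_infinity: "idx \<infinity> = {1..}"
  by (auto simp: idx_def)

lemma idx_enat: "idx (enat n) = {1..n}"
  by (auto simp: idx_def)

text \<open>Once an initial segment contains the support it is mapped onto itself. Hence the means
  over \<open>{1..k}\<close> of a sequence and of its permuted version coincide exactly from
  \<open>k0\<close> on.\<close>

lemma finite_support_permutes_atLeastAtMost: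
  assumes p: "p permutes {1::nat..}" and fin: "finite {n. p n \<noteq> n}"
  obtains k0 where "\<And>k. k \<ge> k0 \<Longrightarrow> p permutes {1..k}"
proof -
  obtain k0 where k0: "\<And>n. p n \<noteq> n \<Longrightarrow> n < k0"
    using fin by (auto simp: finite_nat_set_iff_bounded)
  have "p permutes {1..k}" if "k \<ge> k0" for k
  proof (rule permutes_superset[OF p])
    fix n assume "n \<in> {1..} - {1..k}"
    then show "p n = n" using k0[of n] that by fastforce
  qed
  then show thesis by (rule that)
qed

section \<open>Systems and the action of class permutations\<close>

locale multi_exchangeable_system = prob_space M for M :: "'w measure" +
  fixes C :: nat and N :: "nat \<Rightarrow> enat" and S :: "nat \<Rightarrow> 'a topology"
    and X :: "'w \<Rightarrow> nat \<Rightarrow> nat \<Rightarrow> 'a" and \<Lambda> :: "nat \<Rightarrow> 'w \<Rightarrow> 'a measure"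
  assumes N_ge: "\<And>i. i \<in> {1..C} \<Longrightarrow> N i \<ge> 1"
    and Polish: "\<And>i. i \<in> {1..C} \<Longrightarrow> Polish_space (S i)"
    and X_meas: "\<And>i n. i \<in> {1..C} \<Longrightarrow> n \<in> idx (N i) \<Longrightarrow> (\<lambda>\<omega>. X \<omega> i n) \<in> M \<rightarrow>\<^sub>M borel_of (S i)"
    and exch: "multi_exchangeable M C N S X"
    and mv: "measure_vector M C N S X \<Lambda>"
begin

abbreviation class_space :: "nat \<Rightarrow> (nat \<Rightarrow> 'a) measure" where
  "class_space i \<equiv> PiM (idx (N i)) (\<lambda>_. borel_of (S i))"

abbreviation system_space :: "(nat \<Rightarrow> nat \<Rightarrow> 'a) measure" where
  "system_space \<equiv> PiM {1..C} class_space"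

abbreviation Q :: "nat \<Rightarrow> 'w \<Rightarrow> (nat \<Rightarrow> 'a) measure" where
  "Q \<equiv> Q_meas N S X \<Lambda>"

definition permuted_class :: "(nat \<Rightarrow> nat) \<Rightarrow> nat \<Rightarrow> 'w \<Rightarrow> nat \<Rightarrow> 'a" where
  "permuted_class p i \<omega> = (\<lambda>n\<in>idx (N i). X \<omega> i (p n))"

definition permuted_system :: "(nat \<Rightarrow> nat \<Rightarrow> nat) \<Rightarrow> 'w \<Rightarrow> nat \<Rightarrow> nat \<Rightarrow> 'a" where
  "permuted_system \<sigma> \<omega> = (\<lambda>i\<in>{1..C}. permuted_class (\<sigma> i) i \<omega>)"

definition class_perm :: "nat \<Rightarrow> (nat \<Rightarrow> nat) \<Rightarrow> bool" where
  "class_perm i p \<longleftrightarrow> p permutes idx (N i) \<and> finite {n. p n \<noteq> n}"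

definition system_perm :: "(nat \<Rightarrow> nat \<Rightarrow> nat) \<Rightarrow> bool" where
  "system_perm \<sigma> \<longleftrightarrow> (\<forall>i\<in>{1..C}. class_perm i (\<sigma> i))"

lemma class_perm_id: "class_perm i id"
  by (simp add: class_perm_def permutes_id)

lemma X_in_space:
  assumes "i \<in> {1..C}" "n \<in> idx (N i)" "\<omega> \<in> space M"
  shows "X \<omega> i n \<in> topspace (S i)"
  using measurable_space[OF X_meas[OF assms(1,2)] assms(3)] by simp

lemma measurable_permuted_class:
  assumes i: "i \<in> {1..C}" and p: "class_perm i p"
  shows "permuted_class p i \<in> M \<rightarrow>\<^sub>M class_space i"
  unfolding permuted_class_def
proof (rule measurable_restrict)
  fix n assume "n \<in> idx (N i)"
  then have "p n \<in> idx (N i)"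
    using p permutes_in_image[of p "idx (N i)" n] by (simp add: class_perm_def)
  then show "(\<lambda>\<omega>. X \<omega> i (p n)) \<in> M \<rightarrow>\<^sub>M borel_of (S i)" by (rule X_meas[OF i])
qed

lemma measurable_permuted_system:
  "system_perm \<sigma> \<Longrightarrow> permuted_system \<sigma> \<in> M \<rightarrow>\<^sub>M system_space"
  unfolding permuted_system_def
  by (intro measurable_restrict measurable_permuted_class) (auto simp: system_perm_def)

lemma measurable_coordinate:
  assumes "i \<in> {1..C}" "k \<in> idx (N i)"
  shows "(\<lambda>x. x i k) \<in> system_space \<rightarrow>\<^sub>M borel_of (S i)"
proof (rule measurable_compose[where f = "\<lambda>x. x i" and g = "\<lambda>y. y k"])
  show "(\<lambda>x. x i) \<in> system_space \<rightarrow>\<^sub>M class_space i" by (rule measurable_component_singleton[OF assms(1)])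
  show "(\<lambda>y. y k) \<in> class_space i \<rightarrow>\<^sub>M borel_of (S i)" by (rule measurable_component_singleton[OF assms(2)])
qed

lemma distr_permuted_system:
  assumes "system_perm \<sigma>"
  shows "distr M system_space (permuted_system (\<lambda>_. id)) = distr M system_space (permuted_system \<sigma>)"
proof -
  have eq: "permuted_system \<tau> = (\<lambda>\<omega>. \<lambda>i\<in>{1..C}. \<lambda>n\<in>idx (N i). X \<omega> i (\<tau> i n))" for \<tau>
    by (rule ext) (simp only: permuted_system_def permuted_class_def)
  have "\<forall>i\<in>{1..C}. \<sigma> i permutes idx (N i) \<and> finite {n. \<sigma> i n \<noteq> n}"
    using assms by (simp only: system_perm_def class_perm_def)
  from exch[unfolded multi_exchangeable_def, rule_format, of \<sigma>, OF this[rule_format]]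
  show ?thesis by (simp only: eq id_apply)
qed

lemma finite_class:
  assumes "i \<in> {1..C}" "N i \<noteq> \<infinity>"
  obtains n where "N i = enat n" "n \<ge> 1" "idx (N i) = {1..n}"
    "\<And>\<omega>. \<omega> \<in> space M \<Longrightarrow> X \<omega> i \<in> {1..n} \<rightarrow> space (borel_of (S i))"
    "\<And>\<omega>. \<omega> \<in> space M \<Longrightarrow> \<Lambda> i \<omega> = empirical (borel_of (S i)) n (X \<omega> i)"
    "\<And>\<omega>. Q i \<omega> = lambda_Nk (borel_of (S i)) n n (X \<omega> i)"
proof -
  obtain n where n: "N i = enat n" using assms(2) by auto
  show thesis
  proof
    show "N i = enat n" "idx (N i) = {1..n}" by (simp_all add: n idx_enat)
    show "n \<ge> 1" using N_ge[OF assms(1)] by (simp add: n one_enat_def)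
    show "X \<omega> i \<in> {1..n} \<rightarrow> space (borel_of (S i))" if "\<omega> \<in> space M" for \<omega>
      using X_in_space[OF assms(1) _ that] by (auto simp: n idx_enat)
    show "\<Lambda> i \<omega> = empirical (borel_of (S i)) n (X \<omega> i)" if "\<omega> \<in> space M" for \<omega>
      using mv assms that by (auto simp: measure_vector_def n)
    show "Q i \<omega> = lambda_Nk (borel_of (S i)) n n (X \<omega> i)" for \<omega>
      by (simp add: Q_meas_def n)
  qed
qed

lemma infinite_class:
  assumes "i \<in> {1..C}" "N i = \<infinity>"
  shows "idx (N i) = {1..}" "\<Lambda> i \<in> M \<rightarrow>\<^sub>M prob_algebra (borel_of (S i))"
    "AE \<omega> in M. weak_conv_on (S i) (\<lambda>K. empirical (borel_of (S i)) K (X \<omega> i)) (\<Lambda> i \<omega>)"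
    "Q i \<omega> = PiM (idx (N i)) (\<lambda>_. \<Lambda> i \<omega>)"
  using mv assms by (auto simp: measure_vector_def idx_infinity Q_meas_def)

section \<open>Averages of observations and the measure vector as a coupled quantity\<close>

lemma AE_average_tendsto:
  fixes g :: "'a \<Rightarrow> real"
  assumes i: "i \<in> {1..C}" "N i = \<infinity>" and g: "continuous_map (S i) euclideanreal g" "bounded (g ` topspace (S i))"
  shows "AE \<omega> in M. (\<lambda>K. (\<Sum>k=1..K. g (X \<omega> i k)) / real K) \<longlonglongrightarrow> (\<integral>x. g x \<partial>\<Lambda> i \<omega>)"
  using infinite_class(3)[OF i] AE_space
proof eventually_elim
  fix \<omega> assume w: "weak_conv_on (S i) (\<lambda>K. empirical (borel_of (S i)) K (X \<omega> i)) (\<Lambda> i \<omega>)" and \<omega>: "\<omega> \<in> space M"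
  have "(\<lambda>K. \<integral>x. g x \<partial>empirical (borel_of (S i)) K (X \<omega> i)) \<longlonglongrightarrow> (\<integral>x. g x \<partial>\<Lambda> i \<omega>)"
    using w g unfolding weak_conv_on_def by blast
  moreover have "\<forall>\<^sub>F K in sequentially. (\<integral>x. g x \<partial>empirical (borel_of (S i)) K (X \<omega> i)) = (\<Sum>k=1..K. g (X \<omega> i k)) / real K"
  \<comment> \<open>\<open>K = 0\<close> is left out, since an empirical measure over no
    observations is not a probability measure.\<close>
  proof (rule eventually_sequentiallyI[of 1])
    fix K :: nat assume "1 \<le> K"
    moreover have "X \<omega> i \<in> {1..K} \<rightarrow> space (borel_of (S i))"
      using X_in_space[OF i(1) _ \<omega>] infinite_class(1)[OF i] by auto
    ultimately show "(\<integral>x. g x \<partial>empirical (borel_of (S i)) K (X \<omega> i)) = (\<Sum>k=1..K. g (X \<omega> i k)) / real K"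
      by (rule integral_empirical) (rule continuous_map_borel_of[OF g(1)])
  qed
  ultimately show "(\<lambda>K. (\<Sum>k=1..K. g (X \<omega> i k)) / real K) \<longlonglongrightarrow> (\<integral>x. g x \<partial>\<Lambda> i \<omega>)"
    by (rule Lim_transform_eventually)
qed

text \<open>The integral is almost surely the limit of averages, which is a fixed measurable
  functional of the system. A finitely supported permutation changes only finitely many of these
  averages, so the same functional of the permuted system gives the same value.\<close>

lemma measurable_integral_coupled:
  fixes g :: "'a \<Rightarrow> real"
  assumes \<sigma>: "system_perm \<sigma>" and i: "i \<in> {1..C}" "N i = \<infinity>"
    and g: "continuous_map (S i) euclideanreal g" "bounded (g ` topspace (S i))"
  shows "(\<lambda>\<omega>. \<integral>x. g x \<partial>\<Lambda> i \<omega>) \<in> borel_measurable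
    (coupled M system_space (permuted_system (\<lambda>_. id)) (permuted_system \<sigma>))"
proof (rule measurable_coupledI)
  \<comment> \<open>\<open>lim\<close> is defined, and measurable, everywhere; what it returns on
    divergent averages matters only on a null set.\<close>
  let ?\<phi> = "\<lambda>x. lim (\<lambda>K. (\<Sum>k=1..K. g (x i k)) / real K)"
  have gm: "g \<in> borel_measurable (borel_of (S i))" by (rule continuous_map_borel_of[OF g(1)])
  show "permuted_system (\<lambda>_. id) \<in> M \<rightarrow>\<^sub>M system_space" "permuted_system \<sigma> \<in> M \<rightarrow>\<^sub>M system_space"
    using \<sigma> by (auto intro!: measurable_permuted_system simp: system_perm_def class_perm_id)
  show "(\<lambda>\<omega>. \<integral>x. g x \<partial>\<Lambda> i \<omega>) \<in> borel_measurable M"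
    by (rule measurable_compose[OF measurable_prob_algebraD[OF infinite_class(2)[OF i]]
          integral_measurable_subprob_algebra[OF gm]])
  have comp: "(\<lambda>x. g (x i k)) \<in> borel_measurable system_space" if "k \<in> {1..}" for k
    using that i by (intro measurable_compose[OF measurable_coordinate gm]) (auto simp: idx_infinity)
  show "?\<phi> \<in> borel_measurable system_space"
    by (intro borel_measurable_lim_metric borel_measurable_divide borel_measurable_sum comp) auto
  have ae: "AE \<omega> in M. (\<integral>x. g x \<partial>\<Lambda> i \<omega>) = ?\<phi> (permuted_system \<tau> \<omega>)" if \<tau>: "system_perm \<tau>" for \<tau>
    using AE_average_tendsto[OF i g]
  proof eventually_elim
    fix \<omega> assume lim: "(\<lambda>K. (\<Sum>k=1..K. g (X \<omega> i k)) / real K) \<longlonglongrightarrow> (\<integral>x. g x \<partial>\<Lambda> i \<omega>)"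
    have "\<tau> i permutes idx (N i)" "finite {n. \<tau> i n \<noteq> n}"
      using \<tau> i(1) unfolding system_perm_def class_perm_def by blast+
    then obtain k0 where k0: "\<And>k. k \<ge> k0 \<Longrightarrow> \<tau> i permutes {1..k}"
      unfolding infinite_class(1)[OF i] by (rule finite_support_permutes_atLeastAtMost) blast
    have "\<forall>\<^sub>F K in sequentially. (\<Sum>k=1..K. g (X \<omega> i k)) / real K = (\<Sum>k=1..K. g (permuted_system \<tau> \<omega> i k)) / real K"
    proof (rule eventually_sequentiallyI[of k0])
      fix K assume "k0 \<le> K"
      have "(\<Sum>k=1..K. g (permuted_system \<tau> \<omega> i k)) = (\<Sum>k=1..K. g (X \<omega> i (\<tau> i k)))"
        using i by (intro sum.cong refl) (simp add: permuted_system_def permuted_class_def idx_infinity)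
      then show "(\<Sum>k=1..K. g (X \<omega> i k)) / real K = (\<Sum>k=1..K. g (permuted_system \<tau> \<omega> i k)) / real K"
        using sum.permute[OF k0[OF \<open>k0 \<le> K\<close>], of "\<lambda>k. g (X \<omega> i k)"] by (simp only: o_def)
    qed
    from Lim_transform_eventually[OF lim this] show "(\<integral>x. g x \<partial>\<Lambda> i \<omega>) = ?\<phi> (permuted_system \<tau> \<omega>)"
      by (simp add: limI)
  qed
  show "AE \<omega> in M. (\<integral>x. g x \<partial>\<Lambda> i \<omega>) = ?\<phi> (permuted_system (\<lambda>_. id) \<omega>)"
    by (rule ae) (simp add: system_perm_def class_perm_id)
  show "AE \<omega> in M. (\<integral>x. g x \<partial>\<Lambda> i \<omega>) = ?\<phi> (permuted_system \<sigma> \<omega>)"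
    by (rule ae[OF \<sigma>])
qed

text \<open>For an infinite class the mass of a closed set is a limit of integrals of continuous
  functions, which are coupled already. For a finite class the mass of any Borel set is a symmetric
  function of the observations, so the identity with the permuted system holds at every
  \<open>\<omega>\<close>.\<close>

lemma measurable_Lambda_coupled:
  assumes \<sigma>: "system_perm \<sigma>" and i: "i \<in> {1..C}"
  shows "\<Lambda> i \<in> coupled M system_space (permuted_system (\<lambda>_. id)) (permuted_system \<sigma>) \<rightarrow>\<^sub>M prob_algebra (borel_of (S i))"
    (is "_ \<in> ?W \<rightarrow>\<^sub>M _")
proof (cases "N i = \<infinity>")
  case True
  have L: "\<Lambda> i \<omega> \<in> space (prob_algebra (borel_of (S i)))" if "\<omega> \<in> space M" for \<omega>
    using measurable_space[OF infinite_class(2)[OF i True] that] .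
  show ?thesis
  proof (rule measurable_prob_algebra_generated[OF sets_borel_of_closedin])
    show "Int_stable {F. closedin (S i) F}" by (auto simp: Int_stable_def)
    show "{F. closedin (S i) F} \<subseteq> Pow (topspace (S i))" by (auto dest: closedin_subset)
    show "prob_space (\<Lambda> i \<omega>)" "sets (\<Lambda> i \<omega>) = sets (borel_of (S i))" if "\<omega> \<in> space ?W" for \<omega>
      using prob_algebraD[OF L] that by auto
    fix F assume "F \<in> {F. closedin (S i) F}"
    then have F: "closedin (S i) F" by simp
    obtain g where g: "\<And>m::nat. continuous_map (S i) euclideanreal (g m)"
      "\<And>m x. x \<in> topspace (S i) \<Longrightarrow> 0 \<le> g m x \<and> g m x \<le> 1"
      "\<And>x. x \<in> topspace (S i) \<Longrightarrow> (\<lambda>m. g m x) \<longlonglongrightarrow> indicator F x"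
      using Polish_space_closedin_indicator_limit[OF Polish[OF i] F] by blast
    have bdd: "bounded (g m ` topspace (S i))" for m
      using g(2)[of _ m] by (intro boundedI[of _ 1]) auto
    have "(\<lambda>\<omega>. measure (\<Lambda> i \<omega>) F) \<in> borel_measurable ?W"
    proof (rule borel_measurable_LIMSEQ_real)
      show "(\<lambda>\<omega>. \<integral>x. g m x \<partial>\<Lambda> i \<omega>) \<in> borel_measurable ?W" for m
        by (rule measurable_integral_coupled[OF \<sigma> i True g(1) bdd])
      fix \<omega> assume "\<omega> \<in> space ?W"
      then have \<omega>: "\<omega> \<in> space M" by simp
      interpret L: prob_space "\<Lambda> i \<omega>" by (rule prob_algebraD[OF L[OF \<omega>]])
      note [measurable_cong] = prob_algebraD(2)[OF L[OF \<omega>]]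
      have sp: "space (\<Lambda> i \<omega>) = topspace (S i)" using prob_algebraD(3)[OF L[OF \<omega>]] by simp
      have FM: "F \<in> sets (\<Lambda> i \<omega>)" using closedin_in_sets_borel_of[OF F] prob_algebraD(2)[OF L[OF \<omega>]] by simp
      have "(\<lambda>m. \<integral>x. g m x \<partial>\<Lambda> i \<omega>) \<longlonglongrightarrow> (\<integral>x. indicator F x \<partial>\<Lambda> i \<omega>)"
      proof (rule integral_dominated_convergence[where w = "\<lambda>_. 1"])
        show "g m \<in> borel_measurable (\<Lambda> i \<omega>)" for m
          using continuous_map_borel_of[OF g(1)] by simp
        show "AE x in \<Lambda> i \<omega>. (\<lambda>m. g m x) \<longlonglongrightarrow> indicator F x"
          using g(3) sp by (intro AE_I2) auto
        show "AE x in \<Lambda> i \<omega>. norm (g m x) \<le> 1" for m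
          using g(2) sp by (intro AE_I2) auto
      qed (use FM in auto)
      then show "(\<lambda>m. \<integral>x. g m x \<partial>\<Lambda> i \<omega>) \<longlonglongrightarrow> measure (\<Lambda> i \<omega>) F"
        using FM by simp
    qed
    then have "(\<lambda>\<omega>. ennreal (measure (\<Lambda> i \<omega>) F)) \<in> borel_measurable ?W" by simp
    then show "(\<lambda>\<omega>. emeasure (\<Lambda> i \<omega>) F) \<in> borel_measurable ?W"
    proof (rule measurable_cong[THEN iffD1, rotated])
      fix \<omega> assume "\<omega> \<in> space ?W"
      then interpret L: prob_space "\<Lambda> i \<omega>" using prob_algebraD[OF L] by simp
      show "ennreal (measure (\<Lambda> i \<omega>) F) = emeasure (\<Lambda> i \<omega>) F" by (simp add: L.emeasure_eq_measure)
    qed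
  qed
next
  case False
  obtain n where n: "N i = enat n" "n \<ge> 1" "idx (N i) = {1..n}"
    and X: "\<And>\<omega>. \<omega> \<in> space M \<Longrightarrow> X \<omega> i \<in> {1..n} \<rightarrow> space (borel_of (S i))"
    and L: "\<And>\<omega>. \<omega> \<in> space M \<Longrightarrow> \<Lambda> i \<omega> = empirical (borel_of (S i)) n (X \<omega> i)"
    using finite_class[OF i False] by metis
  show ?thesis
  proof (rule measurable_prob_algebra_generated[OF sets.sigma_sets_eq[symmetric] sets.Int_stable sets.space_closed])
    show "prob_space (\<Lambda> i \<omega>)" "sets (\<Lambda> i \<omega>) = sets (borel_of (S i))" if "\<omega> \<in> space ?W" for \<omega>
      using that L prob_space_empirical[OF n(2) X] by auto
    fix A assume A: "A \<in> sets (borel_of (S i))"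
    let ?\<phi> = "\<lambda>x. ennreal ((\<Sum>k=1..n. indicator A (x i k)) / real n)"
    have eq: "emeasure (\<Lambda> i \<omega>) A = ?\<phi> (permuted_system \<tau> \<omega>)" if \<tau>: "system_perm \<tau>" and \<omega>: "\<omega> \<in> space M" for \<tau> \<omega>
    proof -
      interpret L: prob_space "\<Lambda> i \<omega>" using L[OF \<omega>] prob_space_empirical[OF n(2) X[OF \<omega>]] by simp
      have "\<tau> i permutes idx (N i)" using \<tau> i unfolding system_perm_def class_perm_def by blast
      then have \<tau>i: "\<tau> i permutes {1..n}" by (simp only: n(3))
      have "(\<Sum>k=1..n. indicator A (permuted_system \<tau> \<omega> i k) :: real) = (\<Sum>k=1..n. indicator A (X \<omega> i (\<tau> i k)))"
        using i n by (intro sum.cong refl) (simp add: permuted_system_def permuted_class_def)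
      also have "\<dots> = (\<Sum>k=1..n. indicator A (X \<omega> i k))"
        using sum.permute[OF \<tau>i, of "\<lambda>k. indicator A (X \<omega> i k) :: real"] by (simp only: o_def)
      finally have "(\<Sum>k=1..n. indicator A (permuted_system \<tau> \<omega> i k)) / real n = (\<integral>x. indicator A x \<partial>\<Lambda> i \<omega>)"
        unfolding L[OF \<omega>] integral_empirical[OF n(2) X[OF \<omega>] borel_measurable_indicator[OF A]]
        by (rule arg_cong)
      also have "\<dots> = measure (\<Lambda> i \<omega>) A"
        using sets.sets_into_space[OF A] by (simp add: L[OF \<omega>] Int_absorb2)
      finally show ?thesis by (simp only: L.emeasure_eq_measure)
    qed
    have id: "system_perm (\<lambda>_. id)" by (simp add: system_perm_def class_perm_id)
    have \<phi>: "?\<phi> \<in> borel_measurable system_space"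
    proof -
      have "(\<lambda>x. indicator A (x i k) :: real) \<in> borel_measurable system_space" if "k \<in> {1..n}" for k
        using that i by (intro measurable_compose[OF measurable_coordinate borel_measurable_indicator[OF A]]) (simp_all add: n(3))
      then show ?thesis by (intro measurable_compose[OF _ measurable_ennreal] borel_measurable_divide borel_measurable_sum) auto
    qed
    show "(\<lambda>\<omega>. emeasure (\<Lambda> i \<omega>) A) \<in> borel_measurable ?W"
    proof (rule measurable_coupledI[OF measurable_permuted_system[OF id] measurable_permuted_system[OF \<sigma>] _ \<phi>])
      \<comment> \<open>For a finite class \<open>measure_vector\<close> provides a formula rather
        than measurability, which is therefore read off that formula with the identity
        permutation.\<close>
      show "(\<lambda>\<omega>. emeasure (\<Lambda> i \<omega>) A) \<in> borel_measurable M"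
        using measurable_compose[OF measurable_permuted_system[OF id] \<phi>]
        by (rule measurable_cong[THEN iffD1, rotated]) (rule eq[OF id, symmetric])
    qed (auto intro!: AE_I2 eq id \<sigma>)
  qed
qed

lemma system_perm_id: "system_perm (\<lambda>_. id)"
  by (simp add: system_perm_def class_perm_id)

text \<open>Coupled events are events of \<open>M\<close>, so the previous result for the identity
  permutation suffices.\<close>

lemma measurable_Lambda:
  "i \<in> {1..C} \<Longrightarrow> \<Lambda> i \<in> M \<rightarrow>\<^sub>M prob_algebra (borel_of (S i))"
  by (rule measurable_coupledD[OF measurable_permuted_system measurable_permuted_system
        measurable_Lambda_coupled[OF system_perm_id]]) (rule system_perm_id)+

definition vector_event :: "(nat \<Rightarrow> 'a measure) set \<Rightarrow> 'w set" where
  "vector_event B = {\<omega> \<in> space M. (\<lambda>i\<in>{1..C}. \<Lambda> i \<omega>) \<in> B}"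

text \<open>Events of the measure vector are coupled. This upgrades invariance of the law of the
  system to invariance of its law jointly with the vector.\<close>

lemma integral_vector_event_permuted:
  fixes H :: "(nat \<Rightarrow> nat \<Rightarrow> 'a) \<Rightarrow> real"
  assumes \<sigma>: "system_perm \<sigma>" and B: "B \<in> sets (PiM {1..C} (\<lambda>i. prob_algebra (borel_of (S i))))"
    and H: "H \<in> borel_measurable system_space"
  shows "(\<integral>\<omega>. indicator (vector_event B) \<omega> * H (permuted_system (\<lambda>_. id) \<omega>) \<partial>M)
    = (\<integral>\<omega>. indicator (vector_event B) \<omega> * H (permuted_system \<sigma> \<omega>) \<partial>M)"
proof (rule integral_coupled_eq[OF measurable_permuted_system[OF system_perm_id] measurable_permuted_system[OF \<sigma>]
      distr_permuted_system[OF \<sigma>] _ H])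
  let ?W = "coupled M system_space (permuted_system (\<lambda>_. id)) (permuted_system \<sigma>)"
  have "(\<lambda>\<omega>. \<lambda>i\<in>{1..C}. \<Lambda> i \<omega>) \<in> ?W \<rightarrow>\<^sub>M PiM {1..C} (\<lambda>i. prob_algebra (borel_of (S i)))"
    by (intro measurable_restrict measurable_Lambda_coupled \<sigma>)
  from measurable_sets[OF this B] show "vector_event B \<in> sets ?W"
    by (simp add: vector_event_def vimage_def Int_def conj_commute)
qed

lemma sets_vector_event:
  assumes B: "B \<in> sets (PiM {1..C} (\<lambda>i. prob_algebra (borel_of (S i))))"
  shows "vector_event B \<in> sets M"
proof -
  have "(\<lambda>\<omega>. \<lambda>i\<in>{1..C}. \<Lambda> i \<omega>) \<in> M \<rightarrow>\<^sub>M PiM {1..C} (\<lambda>i. prob_algebra (borel_of (S i)))"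
    by (intro measurable_restrict measurable_Lambda)
  from measurable_sets[OF this B] show ?thesis
    by (simp add: vector_event_def vimage_def Int_def conj_commute)
qed

end

section \<open>Averaging over permutations\<close>

lemma measurable_PiM_component:
  assumes "n \<in> J" "f \<in> M n \<rightarrow>\<^sub>M L"
  shows "(\<lambda>x. f (x n)) \<in> PiM J M \<rightarrow>\<^sub>M L"
  using measurable_component_singleton[OF assms(1)] assms(2) by (rule measurable_compose)

text \<open>The integrand reads only the coordinates in \<open>J\<close>, and the power measure
  projects to a finite product there, even if \<open>I\<close> is infinite.\<close>

lemma integral_PiM_prod:
  fixes g :: "'i \<Rightarrow> 'a \<Rightarrow> real"
  assumes "prob_space \<mu>" "finite J" "J \<subseteq> I" and int: "\<And>n. n \<in> J \<Longrightarrow> integrable \<mu> (g n)"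
  shows "(\<integral>x. (\<Prod>n\<in>J. g n (x n)) \<partial>PiM I (\<lambda>_. \<mu>)) = (\<Prod>n\<in>J. \<integral>y. g n y \<partial>\<mu>)"
proof -
  interpret product_prob_space "\<lambda>_. \<mu>" I by (rule product_prob_spaceI) fact
  have meas: "(\<lambda>x. \<Prod>n\<in>J. g n (x n)) \<in> borel_measurable (PiM J (\<lambda>_. \<mu>))"
    by (intro borel_measurable_prod measurable_PiM_component borel_measurable_integrable int)
  have "(\<integral>x. (\<Prod>n\<in>J. g n (x n)) \<partial>PiM J (\<lambda>_. \<mu>))
    = (\<integral>x. (\<Prod>n\<in>J. g n (x n)) \<partial>distr (PiM I (\<lambda>_. \<mu>)) (PiM J (\<lambda>_. \<mu>)) (\<lambda>x. restrict x J))"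
    by (simp only: distr_PiM_restrict_finite[OF assms(2,3)])
  also have "\<dots> = (\<integral>x. (\<Prod>n\<in>J. g n (restrict x J n)) \<partial>PiM I (\<lambda>_. \<mu>))"
    by (rule integral_distr[OF measurable_restrict_subset[OF assms(3)] meas])
  also have "\<dots> = (\<integral>x. (\<Prod>n\<in>J. g n (x n)) \<partial>PiM I (\<lambda>_. \<mu>))"
    by (intro Bochner_Integration.integral_cong refl prod.cong) simp
  finally show ?thesis
    using product_integral_prod[OF assms(2) int] by simp
qed

text \<open>The block sum is the difference of the initial sums of lengths \<open>n * Suc K\<close>
  and \<open>(n - 1) * Suc K\<close>. Divided by the block length these tend to \<open>n\<close>
  times and \<open>n - 1\<close> times \<open>L\<close>.\<close>

lemma block_average_tendsto:
  fixes f :: "nat \<Rightarrow> real"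
  assumes lim: "(\<lambda>K. (\<Sum>j=1..K. f j) / real K) \<longlonglongrightarrow> L" and n: "n \<ge> 1"
  shows "(\<lambda>K. (\<Sum>j\<in>{(n - 1) * Suc K + 1..n * Suc K}. f j) / real (Suc K)) \<longlonglongrightarrow> L"
proof -
  let ?A = "\<lambda>q K. (\<Sum>j=1..q * Suc K. f j) / real (Suc K)"
  have A: "?A q \<longlonglongrightarrow> real q * L" for q
  \<comment> \<open>For \<open>q = 0\<close>, which occurs at the first block, the sums are empty
    and the lengths \<open>q * Suc K\<close> form no subsequence.\<close>
  proof (cases "q = 0")
    case False
    have "strict_mono (\<lambda>K. q * Suc K)" using False by (simp add: strict_mono_def)
    from LIMSEQ_subseq_LIMSEQ[OF lim this]
    have "(\<lambda>K. real q * ((\<Sum>j=1..q * Suc K. f j) / real (q * Suc K))) \<longlonglongrightarrow> real q * L"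
      unfolding o_def by (rule tendsto_mult[OF tendsto_const])
    moreover have "real q * (x / real (q * Suc K)) = x / real (Suc K)" for x K
      using False by (simp only: of_nat_mult times_divide_eq_right) (rule mult_divide_mult_cancel_left, simp)
    ultimately show ?thesis by (simp only:)
  qed simp
  have "(\<Sum>j\<in>{(n - 1) * Suc K + 1..n * Suc K}. f j) / real (Suc K) = ?A n K - ?A (n - 1) K" for K
  proof -
    have "(n - 1) * Suc K \<le> n * Suc K" by (intro mult_le_mono) auto
    then have "{1..n * Suc K} = {1..(n - 1) * Suc K} \<union> {(n - 1) * Suc K + 1..n * Suc K}"
      by (intro ivl_disj_un_two_touch(4) | auto)+
    then have "(\<Sum>j=1..n * Suc K. f j) =
      (\<Sum>j=1..(n - 1) * Suc K. f j) + (\<Sum>j\<in>{(n - 1) * Suc K + 1..n * Suc K}. f j)"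
      by (simp only:) (rule sum.union_disjoint, auto)
    then show ?thesis by (simp add: diff_divide_distrib[symmetric])
  qed
  moreover have "(\<lambda>K. ?A n K - ?A (n - 1) K) \<longlonglongrightarrow> real n * L - real (n - 1) * L"
    by (intro tendsto_diff A)
  moreover have "real n * L - real (n - 1) * L = L"
    using n by (simp add: of_nat_diff algebra_simps)
  ultimately show ?thesis by simp
qed

text \<open>Within the union, the points outside \<open>A\<close> and the points outside its image
  are equally many, so any bijection between them completes \<open>f\<close>. The permutation moves
  only points of a finite set, as class permutations require.\<close>

lemma inj_on_extends_to_permutation:
  assumes fin: "finite A" and inj: "inj_on f A"
  obtains p where "p permutes (A \<union> f ` A)" "\<And>a. a \<in> A \<Longrightarrow> p a = f a"
proof -
  let ?U = "A \<union> f ` A"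
  have "card (?U - A) = card (?U - f ` A)"
    using fin card_image[OF inj] by (simp add: card_Diff_subset)
  then obtain g where g: "bij_betw g (?U - A) (?U - f ` A)"
    using fin finite_same_card_bij[of "?U - A" "?U - f ` A"] by auto
  define p where "p x = (if x \<in> A then f x else if x \<in> ?U then g x else x)" for x
  have "bij_betw p A (f ` A)"
    using inj_on_imp_bij_betw[OF inj] by (rule bij_betw_cong[THEN iffD2, rotated]) (simp add: p_def)
  moreover have "bij_betw p (?U - A) (?U - f ` A)"
    using g by (rule bij_betw_cong[THEN iffD2, rotated]) (auto simp: p_def)
  ultimately have "bij_betw p (A \<union> (?U - A)) (f ` A \<union> (?U - f ` A))"
    by (rule bij_betw_combine) blast
  moreover have "A \<union> (?U - A) = ?U" "f ` A \<union> (?U - f ` A) = ?U" by blast+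
  ultimately have "bij_betw p ?U ?U" by (simp only:)
  then have "p permutes ?U" by (rule bij_imp_permutes) (simp add: p_def)
  then show thesis by (rule that) (simp add: p_def)
qed

section \<open>The class kernels and the averaging argument\<close>

context multi_exchangeable_system
begin

text \<open>The function is explicit in both cases: the infinite power of a measure, or
  \<open>cond_sample\<close>. The identity holds at every \<omega>, also for an infinite class,
  because \<open>Q\<close> is built from the given version of \<open>\<Lambda> i\<close>.\<close>

lemma Q_function_of_Lambda:
  assumes i: "i \<in> {1..C}"
  obtains F where "F \<in> prob_algebra (borel_of (S i)) \<rightarrow>\<^sub>M prob_algebra (class_space i)"
    "\<And>\<omega>. \<omega> \<in> space M \<Longrightarrow> Q i \<omega> = F (\<Lambda> i \<omega>)"
proof (cases "N i = \<infinity>")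
  case True
  show thesis
  proof (rule that)
    show "(\<lambda>\<mu>. PiM (idx (N i)) (\<lambda>_. \<mu>)) \<in> prob_algebra (borel_of (S i)) \<rightarrow>\<^sub>M prob_algebra (class_space i)"
      by (rule measurable_PiM_prob_algebra) simp
  qed (rule infinite_class(4)[OF i True])
next
  case False
  obtain n where n: "N i = enat n" "n \<ge> 1" "idx (N i) = {1..n}"
    and X: "\<And>\<omega>. \<omega> \<in> space M \<Longrightarrow> X \<omega> i \<in> {1..n} \<rightarrow> space (borel_of (S i))"
    and L: "\<And>\<omega>. \<omega> \<in> space M \<Longrightarrow> \<Lambda> i \<omega> = empirical (borel_of (S i)) n (X \<omega> i)"
    and Q: "\<And>\<omega>. Q i \<omega> = lambda_Nk (borel_of (S i)) n n (X \<omega> i)"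
    using finite_class[OF i False] by metis
  obtain \<A> where "countable \<A>" "Int_stable \<A>" "\<A> \<subseteq> Pow (space (borel_of (S i)))"
    "space (borel_of (S i)) \<in> \<A>" "sets (borel_of (S i)) = sigma_sets (space (borel_of (S i))) \<A>"
    using Polish_space_countable_Int_stable_generator[OF Polish[OF i]] unfolding space_borel_of by blast
  note gen = this
  show thesis
  proof (rule that)
    show "cond_sample (borel_of (S i)) n \<in> prob_algebra (borel_of (S i)) \<rightarrow>\<^sub>M prob_algebra (class_space i)"
      unfolding n(3) by (rule measurable_cond_sample[OF n(2) gen])
    show "Q i \<omega> = cond_sample (borel_of (S i)) n (\<Lambda> i \<omega>)" if "\<omega> \<in> space M" for \<omega>
      unfolding Q L[OF that]
      by (rule cond_sample_empirical[OF n(2) X[OF that] _ gen, symmetric])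
        (simp add: Polish_space_singleton_borel_of[OF Polish[OF i]])
  qed
qed

lemma measurable_Q:
  assumes i: "i \<in> {1..C}"
  shows "Q i \<in> M \<rightarrow>\<^sub>M prob_algebra (class_space i)"
proof -
  obtain F where F: "F \<in> prob_algebra (borel_of (S i)) \<rightarrow>\<^sub>M prob_algebra (class_space i)"
    "\<And>\<omega>. \<omega> \<in> space M \<Longrightarrow> Q i \<omega> = F (\<Lambda> i \<omega>)"
    using Q_function_of_Lambda[OF i] by blast
  show ?thesis
    using measurable_compose[OF measurable_Lambda[OF i] F(1)]
    by (rule measurable_cong[THEN iffD1, rotated]) (rule F(2)[symmetric])
qed

lemma Q_prob:
  assumes "i \<in> {1..C}" "\<omega> \<in> space M"
  shows "prob_space (Q i \<omega>)" "sets (Q i \<omega>) = sets (class_space i)" "space (Q i \<omega>) = space (class_space i)"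
  using prob_algebraD[OF measurable_space[OF measurable_Q[OF assms(1)] assms(2)]] by auto

lemma permuted_class_in_space:
  "i \<in> {1..C} \<Longrightarrow> class_perm i p \<Longrightarrow> \<omega> \<in> space M \<Longrightarrow> permuted_class p i \<omega> \<in> space (class_space i)"
  by (rule measurable_space[OF measurable_permuted_class])

text \<open>The bounds 0 and 1 pass to averages, integrals and products over classes, so the
  constant 1 dominates in every limit below.\<close>

definition unit_test :: "nat \<Rightarrow> ((nat \<Rightarrow> 'a) \<Rightarrow> real) \<Rightarrow> bool" where
  "unit_test i h \<longleftrightarrow> h \<in> borel_measurable (class_space i) \<and> (\<forall>x\<in>space (class_space i). 0 \<le> h x \<and> h x \<le> 1)"

text \<open>The index set is kept apart from the permutations: for an infinite class
  \<open>T\<close> consists of choices of one index per block, and \<open>s\<close> picks a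
  permutation extending each choice.\<close>

definition class_average :: "nat \<Rightarrow> (nat \<Rightarrow> nat) set \<Rightarrow> ((nat \<Rightarrow> nat) \<Rightarrow> nat \<Rightarrow> nat) \<Rightarrow> ((nat \<Rightarrow> 'a) \<Rightarrow> real) \<Rightarrow> 'w \<Rightarrow> real" where
  "class_average i T s h \<omega> = (\<Sum>\<tau>\<in>T. h (permuted_class (s \<tau>) i \<omega>)) / real (card T)"

lemma measurable_unit_test:
  "unit_test i h \<Longrightarrow> i \<in> {1..C} \<Longrightarrow> class_perm i p \<Longrightarrow> (\<lambda>\<omega>. h (permuted_class p i \<omega>)) \<in> borel_measurable M"
  unfolding unit_test_def by (intro measurable_compose[OF measurable_permuted_class]) auto

lemma unit_test_bounds:
  "unit_test i h \<Longrightarrow> i \<in> {1..C} \<Longrightarrow> class_perm i p \<Longrightarrow> \<omega> \<in> space M \<Longrightarrow>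
    0 \<le> h (permuted_class p i \<omega>) \<and> h (permuted_class p i \<omega>) \<le> 1"
  using permuted_class_in_space[of i p \<omega>] unfolding unit_test_def by blast

lemma measurable_class_average:
  assumes "unit_test i h" "i \<in> {1..C}" "\<And>\<tau>. \<tau> \<in> T \<Longrightarrow> class_perm i (s \<tau>)"
  shows "class_average i T s h \<in> borel_measurable M"
proof -
  have "(\<lambda>\<omega>. (\<Sum>\<tau>\<in>T. h (permuted_class (s \<tau>) i \<omega>)) / real (card T)) \<in> borel_measurable M"
    using assms by (intro borel_measurable_divide borel_measurable_const borel_measurable_sum measurable_unit_test)
  then show ?thesis unfolding class_average_def[abs_def] .
qed

lemma class_average_bounds:
  assumes h: "unit_test i h" "i \<in> {1..C}" "\<And>\<tau>. \<tau> \<in> T \<Longrightarrow> class_perm i (s \<tau>)" and \<omega>: "\<omega> \<in> space M"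
  shows "0 \<le> class_average i T s h \<omega>" "class_average i T s h \<omega> \<le> 1"
proof -
  have b: "0 \<le> h (permuted_class (s \<tau>) i \<omega>) \<and> h (permuted_class (s \<tau>) i \<omega>) \<le> 1" if "\<tau> \<in> T" for \<tau>
    by (rule unit_test_bounds[OF h(1,2) h(3)[OF that] \<omega>])
  show "0 \<le> class_average i T s h \<omega>"
    unfolding class_average_def using b by (intro divide_nonneg_nonneg sum_nonneg) auto
  have "(\<Sum>\<tau>\<in>T. h (permuted_class (s \<tau>) i \<omega>)) \<le> real (card T) * 1"
    using b by (intro sum_bounded_above) auto
  then show "class_average i T s h \<omega> \<le> 1"
    unfolding class_average_def by (cases "card T = 0") (simp_all add: divide_le_eq_1)
qed

lemma integrable_vector_event_prod:
  fixes u :: "nat \<Rightarrow> 'w \<Rightarrow> real"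
  assumes E: "E \<in> sets M" and u: "\<And>i. i \<in> {1..C} \<Longrightarrow> u i \<in> borel_measurable M"
    and b: "\<And>i \<omega>. i \<in> {1..C} \<Longrightarrow> \<omega> \<in> space M \<Longrightarrow> 0 \<le> u i \<omega> \<and> u i \<omega> \<le> 1"
  shows "integrable M (\<lambda>\<omega>. indicator E \<omega> * (\<Prod>i\<in>{1..C}. u i \<omega>))"
    "\<And>\<omega>. \<omega> \<in> space M \<Longrightarrow> \<bar>indicator E \<omega> * (\<Prod>i\<in>{1..C}. u i \<omega>)\<bar> \<le> 1"
    "\<And>\<omega>. \<omega> \<in> space M \<Longrightarrow> 0 \<le> indicator E \<omega> * (\<Prod>i\<in>{1..C}. u i \<omega>)"
proof -
  have p: "0 \<le> (\<Prod>i\<in>{1..C}. u i \<omega>)" "(\<Prod>i\<in>{1..C}. u i \<omega>) \<le> 1" if "\<omega> \<in> space M" for \<omega>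
    using b that by (auto intro!: prod_nonneg prod_le_1)
  show b1: "\<bar>indicator E \<omega> * (\<Prod>i\<in>{1..C}. u i \<omega>)\<bar> \<le> 1" if "\<omega> \<in> space M" for \<omega>
    using p[OF that] by (simp add: indicator_def)
  show "0 \<le> indicator E \<omega> * (\<Prod>i\<in>{1..C}. u i \<omega>)" if "\<omega> \<in> space M" for \<omega>
    using p[OF that] by (simp add: indicator_def)
  show "integrable M (\<lambda>\<omega>. indicator E \<omega> * (\<Prod>i\<in>{1..C}. u i \<omega>))"
    using b1 E by (intro integrable_const_bound[where B = 1] AE_I2 borel_measurable_times
        borel_measurable_indicator borel_measurable_prod u) auto
qed

text \<open>Expanding the product of averages gives an average over all choices of one permutation
  per class. Each choice is a permutation of the system, hence contributes the same integral as the
  identity.\<close>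

lemma integral_class_average:
  assumes B: "B \<in> sets (PiM {1..C} (\<lambda>i. prob_algebra (borel_of (S i))))"
    and T: "\<And>i. i \<in> {1..C} \<Longrightarrow> finite (T i)" "\<And>i. i \<in> {1..C} \<Longrightarrow> T i \<noteq> {}"
    and s: "\<And>i \<tau>. i \<in> {1..C} \<Longrightarrow> \<tau> \<in> T i \<Longrightarrow> class_perm i (s i \<tau>)"
    and h: "\<And>i. i \<in> {1..C} \<Longrightarrow> unit_test i (h i)"
  shows "(\<integral>\<omega>. indicator (vector_event B) \<omega> * (\<Prod>i\<in>{1..C}. class_average i (T i) (s i) (h i) \<omega>) \<partial>M)
    = (\<integral>\<omega>. indicator (vector_event B) \<omega> * (\<Prod>i\<in>{1..C}. h i (permuted_class id i \<omega>)) \<partial>M)"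
proof -
  let ?E = "vector_event B"
  let ?P = "PiE {1..C} T"
  define J where "J \<tau> \<omega> = (\<Prod>i\<in>{1..C}. h i (permuted_class (s i (\<tau> i)) i \<omega>))" for \<tau> \<omega>
  define c where "c = (\<Prod>i\<in>{1..C}. real (card (T i)))"
  have fin: "finite ?P" using T by (intro finite_PiE) auto
  have c: "c = real (card ?P)" unfolding c_def by (simp add: card_PiE)
  have "c \<noteq> 0" unfolding c_def using T by simp
  have mem: "\<tau> i \<in> T i" if "\<tau> \<in> ?P" "i \<in> {1..C}" for \<tau> i using PiE_mem[OF that] .
  have J: "(\<integral>\<omega>. indicator ?E \<omega> * J \<tau> \<omega> \<partial>M)
    = (\<integral>\<omega>. indicator ?E \<omega> * (\<Prod>i\<in>{1..C}. h i (permuted_class id i \<omega>)) \<partial>M)" if \<tau>: "\<tau> \<in> ?P" for \<tau>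
  proof -
    let ?H = "\<lambda>x. \<Prod>i\<in>{1..C}. h i (x i)"
    have H: "?H \<in> borel_measurable system_space"
      using h unfolding unit_test_def
      by (intro borel_measurable_prod measurable_PiM_component) auto
    have \<sigma>: "system_perm (\<lambda>i. s i (\<tau> i))"
      unfolding system_perm_def using s mem[OF \<tau>] by blast
    have H_eq: "?H (permuted_system \<sigma> \<omega>) = (\<Prod>i\<in>{1..C}. h i (permuted_class (\<sigma> i) i \<omega>))" for \<sigma> \<omega>
      by (intro prod.cong refl) (simp add: permuted_system_def)
    show ?thesis
      using integral_vector_event_permuted[OF \<sigma> B H] unfolding H_eq J_def by (rule sym)
  qed
  have int: "integrable M (\<lambda>\<omega>. indicator ?E \<omega> * J \<tau> \<omega>)" if \<tau>: "\<tau> \<in> ?P" for \<tau>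
    unfolding J_def
    by (intro integrable_vector_event_prod sets_vector_event[OF B] measurable_unit_test unit_test_bounds h s mem[OF \<tau>])
  have "(\<Prod>i\<in>{1..C}. class_average i (T i) (s i) (h i) \<omega>) = (\<Sum>\<tau>\<in>?P. J \<tau> \<omega>) / c" for \<omega>
    unfolding class_average_def J_def c_def prod_dividef
    by (subst prod_sum_PiE) (use T in auto)
  then have "(\<integral>\<omega>. indicator ?E \<omega> * (\<Prod>i\<in>{1..C}. class_average i (T i) (s i) (h i) \<omega>) \<partial>M)
    = (\<integral>\<omega>. (\<Sum>\<tau>\<in>?P. indicator ?E \<omega> * J \<tau> \<omega>) / c \<partial>M)"
    by (simp add: sum_distrib_left)
  also have "\<dots> = (\<Sum>\<tau>\<in>?P. \<integral>\<omega>. indicator ?E \<omega> * J \<tau> \<omega> \<partial>M) / c"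
    using int by (simp add: Bochner_Integration.integral_sum)
  also have "\<dots> = (\<integral>\<omega>. indicator ?E \<omega> * (\<Prod>i\<in>{1..C}. h i (permuted_class id i \<omega>)) \<partial>M)"
    using \<open>c \<noteq> 0\<close> by (simp add: J c)
  finally show ?thesis .
qed

text \<open>The common interface of finite and infinite classes: suitable permutation averages of
  \<open>h\<close> along the sample recover its integral against \<open>Q i\<close>.\<close>

definition resampled :: "nat \<Rightarrow> ((nat \<Rightarrow> 'a) \<Rightarrow> real) \<Rightarrow> bool" where
  "resampled i h \<longleftrightarrow> unit_test i h \<and>
    (\<exists>T s. (\<forall>K::nat. finite (T K) \<and> T K \<noteq> {} \<and> (\<forall>\<tau>\<in>T K. class_perm i (s K \<tau>))) \<and>
      (AE \<omega> in M. (\<lambda>K. class_average i (T K) (s K) h \<omega>) \<longlonglongrightarrow> (\<integral>x. h x \<partial>Q i \<omega>)))"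

lemma measurable_integral_Q:
  fixes h :: "(nat \<Rightarrow> 'a) \<Rightarrow> real"
  assumes "i \<in> {1..C}" "h \<in> borel_measurable (class_space i)"
  shows "(\<lambda>\<omega>. \<integral>x. h x \<partial>Q i \<omega>) \<in> borel_measurable M"
  by (rule measurable_compose[OF measurable_prob_algebraD[OF measurable_Q[OF assms(1)]]
        integral_measurable_subprob_algebra[OF assms(2)]])

text \<open>The integral of the averaged product is the same for every \<open>K\<close>, namely the
  left side. Dominated convergence identifies its limit with the right side.\<close>

lemma integral_resampled:
  assumes B: "B \<in> sets (PiM {1..C} (\<lambda>i. prob_algebra (borel_of (S i))))"
    and h: "\<And>i. i \<in> {1..C} \<Longrightarrow> resampled i (h i)"
  shows "(\<integral>\<omega>. indicator (vector_event B) \<omega> * (\<Prod>i\<in>{1..C}. h i (permuted_class id i \<omega>)) \<partial>M)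
    = (\<integral>\<omega>. indicator (vector_event B) \<omega> * (\<Prod>i\<in>{1..C}. \<integral>x. h i x \<partial>Q i \<omega>) \<partial>M)"
proof -
  let ?E = "vector_event B"
  have unit: "unit_test i (h i)" if "i \<in> {1..C}" for i
    using h[OF that] unfolding resampled_def by blast
  have "\<forall>i\<in>{1..C}. \<exists>T s. (\<forall>K::nat. finite (T K) \<and> T K \<noteq> {} \<and> (\<forall>\<tau>\<in>T K. class_perm i (s K \<tau>))) \<and>
      (AE \<omega> in M. (\<lambda>K. class_average i (T K) (s K) (h i) \<omega>) \<longlonglongrightarrow> (\<integral>x. h i x \<partial>Q i \<omega>))"
    using h unfolding resampled_def by blast
  from bchoice[OF this] obtain T where
    "\<forall>i\<in>{1..C}. \<exists>s. (\<forall>K::nat. finite (T i K) \<and> T i K \<noteq> {} \<and> (\<forall>\<tau>\<in>T i K. class_perm i (s K \<tau>))) \<and>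
      (AE \<omega> in M. (\<lambda>K. class_average i (T i K) (s K) (h i) \<omega>) \<longlonglongrightarrow> (\<integral>x. h i x \<partial>Q i \<omega>))" ..
  from bchoice[OF this] obtain s where
    "\<forall>i\<in>{1..C}. (\<forall>K::nat. finite (T i K) \<and> T i K \<noteq> {} \<and> (\<forall>\<tau>\<in>T i K. class_perm i (s i K \<tau>))) \<and>
      (AE \<omega> in M. (\<lambda>K. class_average i (T i K) (s i K) (h i) \<omega>) \<longlonglongrightarrow> (\<integral>x. h i x \<partial>Q i \<omega>))" ..
  then have T: "\<And>i K. i \<in> {1..C} \<Longrightarrow> finite (T i K)" "\<And>i K. i \<in> {1..C} \<Longrightarrow> T i K \<noteq> {}"
    and s: "\<And>i K \<tau>. i \<in> {1..C} \<Longrightarrow> \<tau> \<in> T i K \<Longrightarrow> class_perm i (s i K \<tau>)"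
    and lim: "\<And>i. i \<in> {1..C} \<Longrightarrow> AE \<omega> in M. (\<lambda>K. class_average i (T i K) (s i K) (h i) \<omega>) \<longlonglongrightarrow> (\<integral>x. h i x \<partial>Q i \<omega>)"
    by blast+
  let ?f = "\<lambda>K \<omega>. indicator ?E \<omega> * (\<Prod>i\<in>{1..C}. class_average i (T i K) (s i K) (h i) \<omega>)"
  have fK: "integrable M (?f K)" "\<And>\<omega>. \<omega> \<in> space M \<Longrightarrow> \<bar>?f K \<omega>\<bar> \<le> 1" for K
  proof -
    have m: "class_average i (T i K) (s i K) (h i) \<in> borel_measurable M" if "i \<in> {1..C}" for i
      by (rule measurable_class_average[OF unit[OF that] that]) (rule s[OF that])
    have b: "0 \<le> class_average i (T i K) (s i K) (h i) \<omega> \<and> class_average i (T i K) (s i K) (h i) \<omega> \<le> 1"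
      if "i \<in> {1..C}" "\<omega> \<in> space M" for i \<omega>
      by (intro conjI class_average_bounds[OF unit[OF that(1)] that(1) _ that(2)]; rule s[OF that(1)])
    show "integrable M (?f K)"
      by (rule integrable_vector_event_prod(1)[OF sets_vector_event[OF B]]) (rule m b; assumption)+
    show "\<bar>?f K \<omega>\<bar> \<le> 1" if "\<omega> \<in> space M" for \<omega>
      by (rule integrable_vector_event_prod(2)[OF sets_vector_event[OF B] _ _ that]) (rule m b; assumption)+
  qed
  have "(\<lambda>K. \<integral>\<omega>. ?f K \<omega> \<partial>M) \<longlonglongrightarrow> (\<integral>\<omega>. indicator ?E \<omega> * (\<Prod>i\<in>{1..C}. \<integral>x. h i x \<partial>Q i \<omega>) \<partial>M)"
  proof (rule integral_dominated_convergence[where w = "\<lambda>_. 1"])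
    show "?f K \<in> borel_measurable M" for K using fK(1) by (rule borel_measurable_integrable)
    show "(\<lambda>\<omega>. indicator ?E \<omega> * (\<Prod>i\<in>{1..C}. \<integral>x. h i x \<partial>Q i \<omega>)) \<in> borel_measurable M"
      using unit unfolding unit_test_def
      by (intro borel_measurable_times borel_measurable_indicator sets_vector_event[OF B]
          borel_measurable_prod measurable_integral_Q) auto
    show "integrable M (\<lambda>_. 1 :: real)" by simp
    show "AE \<omega> in M. norm (?f K \<omega>) \<le> 1" for K using fK(2) by (intro AE_I2) simp
    have "AE \<omega> in M. \<forall>i\<in>{1..C}. (\<lambda>K. class_average i (T i K) (s i K) (h i) \<omega>) \<longlonglongrightarrow> (\<integral>x. h i x \<partial>Q i \<omega>)"
      using lim by (intro AE_finite_allI) auto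
    then show "AE \<omega> in M. (\<lambda>K. ?f K \<omega>) \<longlonglongrightarrow> indicator ?E \<omega> * (\<Prod>i\<in>{1..C}. \<integral>x. h i x \<partial>Q i \<omega>)"
      by eventually_elim (intro tendsto_mult tendsto_const tendsto_prod, blast)
  qed
  moreover have "(\<integral>\<omega>. ?f K \<omega> \<partial>M) = (\<integral>\<omega>. indicator ?E \<omega> * (\<Prod>i\<in>{1..C}. h i (permuted_class id i \<omega>)) \<partial>M)" for K
    by (rule integral_class_average[OF B T s unit])
  ultimately show ?thesis by (simp add: LIMSEQ_const_iff)
qed

text \<open>The average over all permutations of the class equals the integral at every
  \<open>\<omega>\<close>, so the sequence in \<open>K\<close> is constant.\<close>

lemma resampled_finite:
  assumes i: "i \<in> {1..C}" "N i \<noteq> \<infinity>" and h: "unit_test i h"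
  shows "resampled i h"
proof -
  obtain n where n: "N i = enat n" "n \<ge> 1" "idx (N i) = {1..n}"
    and X: "\<And>\<omega>. \<omega> \<in> space M \<Longrightarrow> X \<omega> i \<in> {1..n} \<rightarrow> space (borel_of (S i))"
    and Q: "\<And>\<omega>. Q i \<omega> = lambda_Nk (borel_of (S i)) n n (X \<omega> i)"
    using finite_class[OF i] by metis
  let ?T = "{p. p permutes {1..n}}"
  have "finite ?T" by (rule finite_permutations) simp
  moreover have "?T \<noteq> {}" using permutes_id[of "{1..n}"] by blast
  moreover have "class_perm i p" if "p \<in> ?T" for p
  proof -
    have p: "p permutes {1..n}" using that by (rule CollectD)
    have "{k. p k \<noteq> k} \<subseteq> {1..n}" using permutes_not_in[OF p] by blast
    then have "finite {k. p k \<noteq> k}" by (rule finite_subset) simp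
    then show ?thesis using p unfolding class_perm_def n(3) by blast
  qed
  moreover have "AE \<omega> in M. (\<lambda>K::nat. class_average i ?T (\<lambda>p. p) h \<omega>) \<longlonglongrightarrow> (\<integral>x. h x \<partial>Q i \<omega>)"
  proof (rule AE_I2)
    fix \<omega> assume \<omega>: "\<omega> \<in> space M"
    have "h \<in> borel_measurable (PiM {1..n} (\<lambda>_. borel_of (S i)))" using h unfolding unit_test_def n(3) by blast
    from integral_lambda_Nk[OF X[OF \<omega>] this]
    have "(\<integral>x. h x \<partial>Q i \<omega>) = class_average i ?T (\<lambda>p. p) h \<omega>"
      unfolding Q class_average_def permuted_class_def n(3)
      by (simp only: card_permutations[OF refl finite_atLeastAtMost] card_atLeastAtMost diff_Suc_1 of_nat_fact)
    then show "(\<lambda>K::nat. class_average i ?T (\<lambda>p. p) h \<omega>) \<longlonglongrightarrow> (\<integral>x. h x \<partial>Q i \<omega>)" by simp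
  qed
  ultimately show ?thesis
    unfolding resampled_def using h by (intro conjI exI[of _ "\<lambda>_. ?T"] exI[of _ "\<lambda>_ p. p"]) auto
qed

text \<open>At stage \<open>K\<close> the \<open>n\<close>-th variable is averaged over the \<open>n\<close>-th block of length \<open>Suc K\<close>. Since the
  blocks are disjoint, every choice of one index per block is injective, and the average of the product
  is exactly the product of the block averages.\<close>
lemma resampled_infinite:
  assumes i: "i \<in> {1..C}" "N i = \<infinity>"
    and g: "\<And>n. continuous_map (S i) euclideanreal (g n)"
    and b: "\<And>n x. x \<in> topspace (S i) \<Longrightarrow> 0 \<le> g n x \<and> g n x \<le> 1"
  shows "resampled i (\<lambda>x. \<Prod>n\<in>{1..k}. g n (x n))" (is "resampled i ?h")
proof -
  note idx = infinite_class(1)[OF i]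
  have gm: "g n \<in> borel_measurable (borel_of (S i))" for n by (rule continuous_map_borel_of[OF g])
  have unit: "unit_test i ?h"
    unfolding unit_test_def
  proof (intro conjI ballI)
    have "(\<lambda>x. g n (x n)) \<in> borel_measurable (class_space i)" if "n \<in> {1..k}" for n
      using that idx by (intro measurable_PiM_component gm) auto
    then show "?h \<in> borel_measurable (class_space i)" by (intro borel_measurable_prod)
    fix x assume "x \<in> space (class_space i)"
    then have "x n \<in> topspace (S i)" if "n \<in> {1..k}" for n
      using that idx by (auto simp: space_PiM)
    then show "0 \<le> ?h x" "?h x \<le> 1" using b by (auto intro!: prod_nonneg prod_le_1)
  qed
  \<comment> \<open>Length \<open>Suc K\<close> keeps the blocks nonempty at \<open>K = 0\<close>;
    only \<open>n \<ge> 1\<close> is used, so the truncated difference \<open>n - 1\<close> is the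
    true one.\<close>
  define block where "block K n = {(n - 1) * Suc K + 1..n * Suc K}" for K n :: nat
  define T where "T K = PiE {1..k} (block K)" for K
  have card_block: "card (block K n) = Suc K" if "n \<in> {1..k}" for K n
    using that by (cases n) (auto simp: block_def)
  \<comment> \<open>A class permutation may move only finitely many indices: the choice is completed
    on the finite union of \<open>{1..k}\<close> and its image, and is the identity
    elsewhere.\<close>
  have ext: "\<exists>p. class_perm i p \<and> (\<forall>n\<in>{1..k}. p n = \<tau> n)" if \<tau>: "\<tau> \<in> T K" for \<tau> K
  proof -
    have bl: "(n - 1) * Suc K + 1 \<le> \<tau> n \<and> \<tau> n \<le> n * Suc K" if "n \<in> {1..k}" for n
      using PiE_mem[OF \<tau>[unfolded T_def] that] by (simp add: block_def)
    have less: "\<tau> n < \<tau> n'" if "n \<in> {1..k}" "n' \<in> {1..k}" "n < n'" for n n'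
    proof -
      have "\<tau> n \<le> n * Suc K" using bl[OF that(1)] by blast
      also have "n * Suc K \<le> (n' - 1) * Suc K" using that(3) by (intro mult_le_mono1) simp
      also have "\<dots> < \<tau> n'" using bl[OF that(2)] by linarith
      finally show ?thesis .
    qed
    have "inj_on \<tau> {1..k}"
    proof (rule inj_onI, rule ccontr)
      fix n n' assume n: "n \<in> {1..k}" "n' \<in> {1..k}" "\<tau> n = \<tau> n'" "n \<noteq> n'"
      then consider "n < n'" | "n' < n" by linarith
      then show False using less[OF n(1,2)] less[OF n(2,1)] n(3) by cases linarith+
    qed
    then obtain p where p: "p permutes ({1..k} \<union> \<tau> ` {1..k})" "\<And>n. n \<in> {1..k} \<Longrightarrow> p n = \<tau> n"
      using inj_on_extends_to_permutation[of "{1..k}" \<tau>] by blast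
    have sub: "{1..k} \<union> \<tau> ` {1..k} \<subseteq> {1..}" using bl by fastforce
    have "{n. p n \<noteq> n} \<subseteq> {1..k} \<union> \<tau> ` {1..k}" using permutes_not_in[OF p(1)] by blast
    then have "finite {n. p n \<noteq> n}" by (rule finite_subset) simp
    then have "class_perm i p" unfolding class_perm_def idx using permutes_subset[OF p(1) sub] by blast
    then show ?thesis using p(2) by blast
  qed
  \<comment> \<open>Any extension serves, since the test function reads the coordinates in
    \<open>{1..k}\<close> only.\<close>
  define s where "s K \<tau> = (SOME p. class_perm i p \<and> (\<forall>n\<in>{1..k}. p n = \<tau> n))" for K :: nat and \<tau>
  have s: "class_perm i (s K \<tau>) \<and> (\<forall>n\<in>{1..k}. s K \<tau> n = \<tau> n)" if "\<tau> \<in> T K" for K \<tau>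
    unfolding s_def by (rule someI_ex[OF ext[OF that]])
  have finT: "finite (T K)" for K unfolding T_def by (intro finite_PiE) (auto simp: block_def)
  have cardT: "card (T K) = (\<Prod>n\<in>{1..k}. Suc K)" for K
    unfolding T_def by (simp add: card_PiE card_block)
  have neT: "T K \<noteq> {}" for K using cardT[of K] by auto
  have avg: "class_average i (T K) (s K) ?h \<omega> = (\<Prod>n\<in>{1..k}. (\<Sum>j\<in>block K n. g n (X \<omega> i j)) / real (Suc K))" for K \<omega>
  proof -
    have "?h (permuted_class (s K \<tau>) i \<omega>) = (\<Prod>n\<in>{1..k}. g n (X \<omega> i (\<tau> n)))" if "\<tau> \<in> T K" for \<tau>
      using s[OF that] idx by (intro prod.cong refl) (simp add: permuted_class_def)
    then have "(\<Sum>\<tau>\<in>T K. ?h (permuted_class (s K \<tau>) i \<omega>)) = (\<Sum>\<tau>\<in>T K. \<Prod>n\<in>{1..k}. g n (X \<omega> i (\<tau> n)))"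
      by (rule sum.cong[OF refl])
    also have "\<dots> = (\<Prod>n\<in>{1..k}. \<Sum>j\<in>block K n. g n (X \<omega> i j))"
      unfolding T_def by (rule prod_sum_PiE[symmetric]) (auto simp: block_def)
    finally show ?thesis
      unfolding class_average_def prod_dividef cardT by (simp only: of_nat_prod)
  qed
  have bdd: "bounded (g n ` topspace (S i))" for n
    using b[of _ n] by (intro boundedI[of _ 1]) auto
  have "AE \<omega> in M. \<forall>n\<in>{1..k}. (\<lambda>K. (\<Sum>j=1..K. g n (X \<omega> i j)) / real K) \<longlonglongrightarrow> (\<integral>x. g n x \<partial>\<Lambda> i \<omega>)"
    by (intro AE_finite_allI AE_average_tendsto[OF i g bdd]) simp
  then have "AE \<omega> in M. (\<lambda>K. class_average i (T K) (s K) ?h \<omega>) \<longlonglongrightarrow> (\<integral>x. ?h x \<partial>Q i \<omega>)"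
    using AE_space
  proof eventually_elim
    fix \<omega> assume lim: "\<forall>n\<in>{1..k}. (\<lambda>K. (\<Sum>j=1..K. g n (X \<omega> i j)) / real K) \<longlonglongrightarrow> (\<integral>x. g n x \<partial>\<Lambda> i \<omega>)"
      and \<omega>: "\<omega> \<in> space M"
    have L: "\<Lambda> i \<omega> \<in> space (prob_algebra (borel_of (S i)))"
      by (rule measurable_space[OF measurable_Lambda[OF i(1)] \<omega>])
    interpret L: prob_space "\<Lambda> i \<omega>" by (rule prob_algebraD[OF L])
    have "integrable (\<Lambda> i \<omega>) (g n)" for n
      using gm[of n] b prob_algebraD(2,3)[OF L]
      by (intro L.integrable_const_bound[where B = 1] AE_I2) (auto cong: measurable_cong_sets)
    then have "(\<integral>x. ?h x \<partial>Q i \<omega>) = (\<Prod>n\<in>{1..k}. \<integral>x. g n x \<partial>\<Lambda> i \<omega>)"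
      unfolding infinite_class(4)[OF i] idx by (intro integral_PiM_prod L.prob_space_axioms) auto
    moreover have "(\<lambda>K. class_average i (T K) (s K) ?h \<omega>) \<longlonglongrightarrow> (\<Prod>n\<in>{1..k}. \<integral>x. g n x \<partial>\<Lambda> i \<omega>)"
      unfolding avg block_def
    proof (intro tendsto_prod block_average_tendsto)
      fix n assume n: "n \<in> {1..k}"
      show "(\<lambda>K. (\<Sum>j=1..K. g n (X \<omega> i j)) / real K) \<longlonglongrightarrow> (\<integral>x. g n x \<partial>\<Lambda> i \<omega>)" using lim n by blast
      show "1 \<le> n" using n by simp
    qed
    ultimately show "(\<lambda>K. class_average i (T K) (s K) ?h \<omega>) \<longlonglongrightarrow> (\<integral>x. ?h x \<partial>Q i \<omega>)" by simp
  qed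
  then show ?thesis
    unfolding resampled_def using unit finT neT s by (intro conjI exI[of _ T] exI[of _ s]) auto
qed

end

section \<open>The conditional law\<close>

text \<open>Comparison of sigma-algebras becomes measurability of the identity, which into a product
  space can be checked one coordinate at a time.\<close>

lemma sets_subset_of_measurable_ident:
  assumes "(\<lambda>x. x) \<in> M \<rightarrow>\<^sub>M N" "space M = space N"
  shows "sets N \<subseteq> sets M"
proof
  fix A assume A: "A \<in> sets N"
  have "A = (\<lambda>x. x) -` A \<inter> space M"
    using sets.sets_into_space[OF A] assms(2) by auto
  also have "\<dots> \<in> sets M" by (rule measurable_sets[OF assms(1) A])
  finally show "A \<in> sets M" .
qed

context multi_exchangeable_system
begin

text \<open>Since \<open>resampled\<close> includes the bounds 0 and 1, pointwise convergence is
  enough to pass to the limit under every integral involved.\<close>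

definition test_limit :: "nat \<Rightarrow> (nat \<Rightarrow> 'a) set \<Rightarrow> bool" where
  "test_limit i A \<longleftrightarrow> A \<in> sets (class_space i) \<and>
    (\<exists>h::nat \<Rightarrow> (nat \<Rightarrow> 'a) \<Rightarrow> real. (\<forall>m. resampled i (h m)) \<and>
      (\<forall>x\<in>space (class_space i). (\<lambda>m. h m x) \<longlonglongrightarrow> indicator A x))"

text \<open>For an infinite class, cylinders over closed sets are what products of continuous
  functions can approximate. For a finite class every measurable indicator is itself
  \<open>resampled\<close>, so the whole sigma-algebra can be taken.\<close>

definition generator :: "nat \<Rightarrow> (nat \<Rightarrow> 'a) set set" where
  "generator i = (if N i = \<infinity>
     then {{x \<in> space (class_space i). \<forall>n\<in>{1..k}. x n \<in> F n} | k F. \<forall>n::nat. closedin (S i) (F n)}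
     else sets (class_space i))"

lemma closed_cylinder_in_generator:
  assumes "N i = \<infinity>" "\<And>n::nat. closedin (S i) (F n)"
  shows "{x \<in> space (class_space i). \<forall>n\<in>{1..k}. x n \<in> F n} \<in> generator i"
  unfolding generator_def if_P[OF assms(1)] using assms(2) by blast

lemma generator_finite: "N i \<noteq> \<infinity> \<Longrightarrow> generator i = sets (class_space i)"
  unfolding generator_def by (rule if_not_P)

text \<open>A closed cylinder is approximated by the product of the Urysohn functions of its
  finitely many sides; for a finite class a constant sequence works.\<close>

lemma generator_test_limit:
  assumes i: "i \<in> {1..C}" and A: "A \<in> generator i"
  shows "test_limit i A"
proof (cases "N i = \<infinity>")
  case True
  note idx = infinite_class(1)[OF i True]
  obtain k F where F: "\<And>n::nat. closedin (S i) (F n)"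
    and A_eq: "A = {x \<in> space (class_space i). \<forall>n\<in>{1..k}. x n \<in> F n}"
    using A True unfolding generator_def by auto
  have "{x \<in> space (class_space i). x n \<in> F n} \<in> sets (class_space i)" if "n \<in> {1..k}" for n
  proof -
    have "n \<in> idx (N i)" using that idx by auto
    from measurable_sets[OF measurable_component_singleton[OF this] closedin_in_sets_borel_of[OF F]]
    show ?thesis by (simp add: vimage_def Int_def conj_commute)
  qed
  then have "A \<in> sets (class_space i)"
    unfolding A_eq by (intro sets.sets_Collect_finite_All) auto
  moreover have "\<exists>g. (\<forall>m::nat. continuous_map (S i) euclideanreal (g m)) \<and>
      (\<forall>m. \<forall>x\<in>topspace (S i). 0 \<le> g m x \<and> g m x \<le> 1) \<and>
      (\<forall>x\<in>topspace (S i). (\<lambda>m. g m x) \<longlonglongrightarrow> indicator (F n) x)" for n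
    using Polish_space_closedin_indicator_limit[OF Polish[OF i] F[of n]] by metis
  then obtain g where g: "\<And>n m::nat. continuous_map (S i) euclideanreal (g n m)"
    "\<And>n m x. x \<in> topspace (S i) \<Longrightarrow> 0 \<le> g n m x \<and> g n m x \<le> 1"
    "\<And>n x. x \<in> topspace (S i) \<Longrightarrow> (\<lambda>m. g n m x) \<longlonglongrightarrow> (indicator (F n) x :: real)"
    by metis
  have "resampled i (\<lambda>x. \<Prod>n\<in>{1..k}. g n m (x n))" for m
    by (rule resampled_infinite[OF i True g(1) g(2)])
  moreover have "(\<lambda>m. \<Prod>n\<in>{1..k}. g n m (x n)) \<longlonglongrightarrow> indicator A x" if x: "x \<in> space (class_space i)" for x
  proof -
    have xn: "x n \<in> topspace (S i)" if "n \<in> {1..k}" for n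
      using x that idx by (auto simp: space_PiM)
    have "(\<lambda>m. \<Prod>n\<in>{1..k}. g n m (x n)) \<longlonglongrightarrow> (\<Prod>n\<in>{1..k}. indicator (F n) (x n))"
      by (intro tendsto_prod g(3) xn)
    moreover have "(\<Prod>n\<in>{1..k}. indicator (F n) (x n) :: real) = indicator A x"
    proof (cases "x \<in> A")
      case False
      then obtain n where "n \<in> {1..k}" "x n \<notin> F n" using x unfolding A_eq by blast
      then have "(\<Prod>n\<in>{1..k}. indicator (F n) (x n) :: real) = 0"
        by (intro prod_zero bexI[of _ n]) auto
      then show ?thesis using False by simp
    qed (simp add: A_eq)
    ultimately show ?thesis by simp
  qed
  ultimately show ?thesis
    unfolding test_limit_def by (intro conjI exI[of _ "\<lambda>m x. \<Prod>n\<in>{1..k}. g n m (x n)"] allI ballI)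
next
  case False
  from A have A: "A \<in> sets (class_space i)" unfolding generator_finite[OF False] .
  then have "unit_test i (indicator A)" unfolding unit_test_def by (auto simp: indicator_def)
  then have "resampled i (indicator A)" by (rule resampled_finite[OF i False])
  then show ?thesis
    unfolding test_limit_def using A by (intro conjI exI[of _ "\<lambda>_. indicator A"]) auto
qed

text \<open>Two nested dominated convergences: inside each \<open>Q i \<omega>\<close> the test
  integrals tend to the mass of \<open>A i\<close>, then the products over classes converge under
  the integral over \<open>M\<close>. At each stage \<open>m\<close> the two sides agree because the
  test functions are \<open>resampled\<close>.\<close>

lemma integral_test_limit:
  assumes B: "B \<in> sets (PiM {1..C} (\<lambda>i. prob_algebra (borel_of (S i))))"
    and A: "\<And>i. i \<in> {1..C} \<Longrightarrow> test_limit i (A i)"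
  shows "(\<integral>\<omega>. indicator (vector_event B) \<omega> * (\<Prod>i\<in>{1..C}. indicator (A i) (permuted_class id i \<omega>)) \<partial>M)
    = (\<integral>\<omega>. indicator (vector_event B) \<omega> * (\<Prod>i\<in>{1..C}. measure (Q i \<omega>) (A i)) \<partial>M)"
proof -
  let ?E = "vector_event B"
  note E = sets_vector_event[OF B]
  have A_sets: "A i \<in> sets (class_space i)" if "i \<in> {1..C}" for i
    using A[OF that] unfolding test_limit_def by blast
  have "\<forall>i\<in>{1..C}. \<exists>h::nat \<Rightarrow> (nat \<Rightarrow> 'a) \<Rightarrow> real. (\<forall>m. resampled i (h m)) \<and>
      (\<forall>x\<in>space (class_space i). (\<lambda>m. h m x) \<longlonglongrightarrow> indicator (A i) x)"
    using A unfolding test_limit_def by blast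
  from bchoice[OF this] obtain h :: "nat \<Rightarrow> nat \<Rightarrow> (nat \<Rightarrow> 'a) \<Rightarrow> real" where
    "\<forall>i\<in>{1..C}. (\<forall>m. resampled i (h i m)) \<and> (\<forall>x\<in>space (class_space i). (\<lambda>m. h i m x) \<longlonglongrightarrow> indicator (A i) x)" ..
  then have res: "\<And>i m. i \<in> {1..C} \<Longrightarrow> resampled i (h i m)"
    and lim: "\<And>i x. i \<in> {1..C} \<Longrightarrow> x \<in> space (class_space i) \<Longrightarrow> (\<lambda>m. h i m x) \<longlonglongrightarrow> indicator (A i) x"
    by blast+
  have unit: "unit_test i (h i m)" if "i \<in> {1..C}" for i m
    using res[OF that] unfolding resampled_def by blast
  have hm: "h i m \<in> borel_measurable (class_space i)" if "i \<in> {1..C}" for i m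
    using unit[OF that] unfolding unit_test_def by blast
  have hb: "0 \<le> h i m x \<and> h i m x \<le> 1" if "i \<in> {1..C}" "x \<in> space (class_space i)" for i m x
    using unit[OF that(1)] that(2) unfolding unit_test_def by blast
  have id: "class_perm i id" for i by (rule class_perm_id)
  have lhs: "(\<lambda>m. \<integral>\<omega>. indicator ?E \<omega> * (\<Prod>i\<in>{1..C}. h i m (permuted_class id i \<omega>)) \<partial>M)
    \<longlonglongrightarrow> (\<integral>\<omega>. indicator ?E \<omega> * (\<Prod>i\<in>{1..C}. indicator (A i) (permuted_class id i \<omega>)) \<partial>M)"
  proof (rule integral_dominated_convergence[where w = "\<lambda>_. 1"])
    show "(\<lambda>\<omega>. indicator ?E \<omega> * (\<Prod>i\<in>{1..C}. indicator (A i) (permuted_class id i \<omega>)) :: real) \<in> borel_measurable M"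
      by (intro borel_measurable_times borel_measurable_indicator E borel_measurable_prod
          measurable_compose[OF measurable_permuted_class[OF _ id]] A_sets)
    show "(\<lambda>\<omega>. indicator ?E \<omega> * (\<Prod>i\<in>{1..C}. h i m (permuted_class id i \<omega>))) \<in> borel_measurable M" for m
      by (intro borel_measurable_times borel_measurable_indicator E borel_measurable_prod
          measurable_unit_test[OF unit _ id])
    show "AE \<omega> in M. norm (indicator ?E \<omega> * (\<Prod>i\<in>{1..C}. h i m (permuted_class id i \<omega>))) \<le> 1" for m
    proof (rule AE_I2)
      fix \<omega> assume \<omega>: "\<omega> \<in> space M"
      show "norm (indicator ?E \<omega> * (\<Prod>i\<in>{1..C}. h i m (permuted_class id i \<omega>))) \<le> 1"
        unfolding real_norm_def
        by (rule integrable_vector_event_prod(2)[OF E _ _ \<omega>])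
          (rule measurable_unit_test[OF unit _ id] unit_test_bounds[OF unit _ id]; assumption)+
    qed
    show "AE \<omega> in M. (\<lambda>m. indicator ?E \<omega> * (\<Prod>i\<in>{1..C}. h i m (permuted_class id i \<omega>)))
      \<longlonglongrightarrow> indicator ?E \<omega> * (\<Prod>i\<in>{1..C}. indicator (A i) (permuted_class id i \<omega>))"
      by (intro AE_I2 tendsto_mult tendsto_const tendsto_prod lim permuted_class_in_space id)
  qed simp
  have Qlim: "(\<lambda>m. \<integral>x. h i m x \<partial>Q i \<omega>) \<longlonglongrightarrow> measure (Q i \<omega>) (A i)"
    and Qb: "0 \<le> (\<integral>x. h i m x \<partial>Q i \<omega>) \<and> (\<integral>x. h i m x \<partial>Q i \<omega>) \<le> 1"
    if i: "i \<in> {1..C}" and \<omega>: "\<omega> \<in> space M" for i \<omega> m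
  proof -
    interpret Qi: prob_space "Q i \<omega>" by (rule Q_prob[OF i \<omega>])
    note sQ = Q_prob(2,3)[OF i \<omega>]
    have hQ: "h i m \<in> borel_measurable (Q i \<omega>)" for m
      using hm[OF i] by (simp add: measurable_cong_sets[OF sQ(1) refl])
    have hQb: "AE x in Q i \<omega>. 0 \<le> h i m x \<and> h i m x \<le> 1" for m
      using hb[OF i] sQ(2) by (intro AE_I2) auto
    have AQ: "A i \<in> sets (Q i \<omega>)" using A_sets[OF i] sQ by simp
    have "(\<lambda>m. \<integral>x. h i m x \<partial>Q i \<omega>) \<longlonglongrightarrow> (\<integral>x. indicator (A i) x \<partial>Q i \<omega>)"
    proof (rule integral_dominated_convergence[where w = "\<lambda>_. 1"])
      show "indicator (A i) \<in> borel_measurable (Q i \<omega>)" using AQ by simp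
      show "AE x in Q i \<omega>. norm (h i m x) \<le> 1" for m using hQb[of m] by eventually_elim simp
      show "AE x in Q i \<omega>. (\<lambda>m. h i m x) \<longlonglongrightarrow> indicator (A i) x"
        using lim[OF i] sQ(2) by (intro AE_I2) auto
    qed (use hQ in auto)
    then show "(\<lambda>m. \<integral>x. h i m x \<partial>Q i \<omega>) \<longlonglongrightarrow> measure (Q i \<omega>) (A i)"
      using AQ by simp
    have "integrable (Q i \<omega>) (h i m)"
      using hQb[of m] by (intro Qi.integrable_const_bound[where B = 1] hQ) auto
    then show "0 \<le> (\<integral>x. h i m x \<partial>Q i \<omega>) \<and> (\<integral>x. h i m x \<partial>Q i \<omega>) \<le> 1"
      using hQb[of m] by (intro conjI integral_nonneg_AE Qi.integral_le_const) auto
  qed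
  have "(\<lambda>m. \<integral>\<omega>. indicator ?E \<omega> * (\<Prod>i\<in>{1..C}. \<integral>x. h i m x \<partial>Q i \<omega>) \<partial>M)
    \<longlonglongrightarrow> (\<integral>\<omega>. indicator ?E \<omega> * (\<Prod>i\<in>{1..C}. measure (Q i \<omega>) (A i)) \<partial>M)"
  proof (rule integral_dominated_convergence[where w = "\<lambda>_. 1"])
    show "(\<lambda>\<omega>. indicator ?E \<omega> * (\<Prod>i\<in>{1..C}. measure (Q i \<omega>) (A i))) \<in> borel_measurable M"
      by (intro borel_measurable_times borel_measurable_indicator E borel_measurable_prod
          measurable_compose[OF measurable_prob_algebraD[OF measurable_Q] measurable_measure_subprob_algebra] A_sets)
    show "(\<lambda>\<omega>. indicator ?E \<omega> * (\<Prod>i\<in>{1..C}. \<integral>x. h i m x \<partial>Q i \<omega>)) \<in> borel_measurable M" for m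
      by (intro borel_measurable_times borel_measurable_indicator E borel_measurable_prod measurable_integral_Q hm)
    show "AE \<omega> in M. norm (indicator ?E \<omega> * (\<Prod>i\<in>{1..C}. \<integral>x. h i m x \<partial>Q i \<omega>)) \<le> 1" for m
    proof (rule AE_I2)
      fix \<omega> assume \<omega>: "\<omega> \<in> space M"
      show "norm (indicator ?E \<omega> * (\<Prod>i\<in>{1..C}. \<integral>x. h i m x \<partial>Q i \<omega>)) \<le> 1"
        unfolding real_norm_def
        by (rule integrable_vector_event_prod(2)[OF E _ _ \<omega>])
          (rule measurable_integral_Q[OF _ hm] Qb; assumption)+
    qed
    show "AE \<omega> in M. (\<lambda>m. indicator ?E \<omega> * (\<Prod>i\<in>{1..C}. \<integral>x. h i m x \<partial>Q i \<omega>))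
      \<longlonglongrightarrow> indicator ?E \<omega> * (\<Prod>i\<in>{1..C}. measure (Q i \<omega>) (A i))"
      by (intro AE_I2 tendsto_mult tendsto_const tendsto_prod Qlim)
  qed simp
  moreover have "(\<integral>\<omega>. indicator ?E \<omega> * (\<Prod>i\<in>{1..C}. h i m (permuted_class id i \<omega>)) \<partial>M)
    = (\<integral>\<omega>. indicator ?E \<omega> * (\<Prod>i\<in>{1..C}. \<integral>x. h i m x \<partial>Q i \<omega>) \<partial>M)" for m
    by (rule integral_resampled[OF B res])
  ultimately show ?thesis using lhs by (simp only: LIMSEQ_unique)
qed

lemma generator_subset:
  "i \<in> {1..C} \<Longrightarrow> generator i \<subseteq> sets (class_space i)"
  using generator_test_limit unfolding test_limit_def by blast

lemma space_in_generator: "space (class_space i) \<in> generator i"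
proof (cases "N i = \<infinity>")
  case True
  \<comment> \<open>Length \<open>k = 0\<close>: a cylinder without conditions.\<close>
  have "space (class_space i) = {x \<in> space (class_space i). \<forall>n\<in>{1..0}. x n \<in> topspace (S i)}" by simp
  also have "\<dots> \<in> generator i" by (rule closed_cylinder_in_generator[OF True]) simp
  finally show ?thesis .
next
  case False
  show ?thesis unfolding generator_finite[OF False] by (rule sets.top)
qed

lemma Int_in_generator:
  assumes "a \<in> generator i" "b \<in> generator i"
  shows "a \<inter> b \<in> generator i"
proof (cases "N i = \<infinity>")
  case True
  note idx = idx_infinity[folded True]
  obtain k F where F: "\<And>n::nat. closedin (S i) (F n)"
    and a: "a = {x \<in> space (class_space i). \<forall>n\<in>{1..k}. x n \<in> F n}"
    using assms(1) True unfolding generator_def by auto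
  obtain l G where G: "\<And>n::nat. closedin (S i) (G n)"
    and b: "b = {x \<in> space (class_space i). \<forall>n\<in>{1..l}. x n \<in> G n}"
    using assms(2) True unfolding generator_def by auto
  \<comment> \<open>Each cylinder is padded with full sides up to the common length
    \<open>max k l\<close>.\<close>
  define H where "H n = (if n \<le> k then F n else topspace (S i)) \<inter> (if n \<le> l then G n else topspace (S i))" for n
  have "a \<inter> b = {x \<in> space (class_space i). \<forall>n\<in>{1..max k l}. x n \<in> H n}"
  proof -
    have "x n \<in> topspace (S i)" if "x \<in> space (class_space i)" "1 \<le> n" for x n
      using that idx by (auto simp: space_PiM)
    then show ?thesis unfolding a b H_def by auto
  qed
  moreover have "closedin (S i) (H n)" for n using F G by (auto simp: H_def)
  ultimately show ?thesis using closed_cylinder_in_generator[OF True, of H "max k l"] by simp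
next
  case False
  show ?thesis using assms unfolding generator_finite[OF False] by (rule sets.Int)
qed

text \<open>The product sigma-algebra is determined by single coordinates, and a closed condition on
  one coordinate is a closed cylinder.\<close>

lemma generator_generates:
  assumes i: "i \<in> {1..C}"
  shows "sets (class_space i) = sigma_sets (space (class_space i)) (generator i)"
proof (cases "N i = \<infinity>")
  case True
  note idx = infinite_class(1)[OF i True]
  let ?G = "sigma (space (class_space i)) (generator i)"
  have pow: "generator i \<subseteq> Pow (space (class_space i))"
    using generator_subset[OF i] sets.space_closed by blast
  have spG: "space ?G = space (class_space i)" by (rule space_measure_of[OF pow])
  have seG: "sets ?G = sigma_sets (space (class_space i)) (generator i)" by (rule sets_measure_of[OF pow])
  have "(\<lambda>x. x) \<in> ?G \<rightarrow>\<^sub>M class_space i"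
  proof (rule measurable_PiM_single')
    show "(\<lambda>x. x) \<in> space ?G \<rightarrow> idx (N i) \<rightarrow>\<^sub>E space (borel_of (S i))"
      unfolding spG by (simp add: space_PiM)
    fix n assume n: "n \<in> idx (N i)"
    show "(\<lambda>x. x n) \<in> ?G \<rightarrow>\<^sub>M borel_of (S i)"
    proof (rule measurable_sigma_sets[OF sets_borel_of_closedin])
      show "{F. closedin (S i) F} \<subseteq> Pow (topspace (S i))" by (auto dest: closedin_subset)
      show "(\<lambda>x. x n) \<in> space ?G \<rightarrow> topspace (S i)"
        unfolding spG using n by (auto simp: space_PiM)
      fix F assume "F \<in> {F. closedin (S i) F}"
      then have F: "closedin (S i) F" by simp
      \<comment> \<open>A condition on coordinate \<open>n\<close> alone, written as a cylinder of
        length \<open>n\<close> whose earlier sides are full.\<close>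
      let ?F = "\<lambda>m. if m = n then F else topspace (S i)"
      have "x m \<in> topspace (S i)" if "x \<in> space (class_space i)" "m \<in> {1..n}" for x m
        using that idx by (auto simp: space_PiM)
      then have "(\<lambda>x. x n) -` F \<inter> space ?G = {x \<in> space (class_space i). \<forall>m\<in>{1..n}. x m \<in> ?F m}"
        unfolding spG using n idx by auto
      moreover have "{x \<in> space (class_space i). \<forall>m\<in>{1..n}. x m \<in> ?F m} \<in> generator i"
        by (rule closed_cylinder_in_generator[OF True]) (simp add: F)
      ultimately show "(\<lambda>x. x n) -` F \<inter> space ?G \<in> sets ?G"
        unfolding seG by (simp add: sigma_sets.Basic)
    qed
  qed
  then have "sets (class_space i) \<subseteq> sets ?G"
    using spG by (rule sets_subset_of_measurable_ident)
  then show ?thesis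
    unfolding seG using sets.sigma_sets_subset[OF generator_subset[OF i]] by blast
next
  case False
  show ?thesis unfolding generator_finite[OF False] by (rule sets.sigma_sets_eq[symmetric])
qed

section \<open>Boxes over the classes and the identification of the conditional law\<close>

definition boxes :: "(nat \<Rightarrow> nat \<Rightarrow> 'a) set set" where
  "boxes = {Pi\<^sub>E {1..C} F | F. \<forall>i\<in>{1..C}. F i \<in> generator i}"

lemma Int_stable_boxes: "Int_stable boxes"
proof (rule Int_stableI)
  fix a b assume "a \<in> boxes" "b \<in> boxes"
  then obtain F G where "a = Pi\<^sub>E {1..C} F" "b = Pi\<^sub>E {1..C} G"
    "\<forall>i\<in>{1..C}. F i \<in> generator i" "\<forall>i\<in>{1..C}. G i \<in> generator i"
    unfolding boxes_def by blast
  then show "a \<inter> b \<in> boxes"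
    unfolding boxes_def using Int_in_generator
    by (intro CollectI exI[of _ "\<lambda>i. F i \<inter> G i"]) (simp add: PiE_Int)
qed

lemma boxes_subset: "boxes \<subseteq> sets system_space"
proof
  fix D assume "D \<in> boxes"
  then obtain F where "D = Pi\<^sub>E {1..C} F" "\<forall>i\<in>{1..C}. F i \<in> generator i"
    unfolding boxes_def by blast
  then show "D \<in> sets system_space"
    using generator_subset by (simp only:) (intro sets_PiM_I_finite, simp, blast)
qed

lemma space_in_boxes: "space system_space \<in> boxes"
  unfolding boxes_def using space_in_generator by (auto simp: space_PiM[of "{1..C}"])

lemma boxes_generate: "sets system_space = sigma_sets (space system_space) boxes"
proof -
  let ?G = "sigma (space system_space) boxes"
  have pow: "boxes \<subseteq> Pow (space system_space)"
    using boxes_subset sets.space_closed by blast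
  have spG: "space ?G = space system_space" by (rule space_measure_of[OF pow])
  have seG: "sets ?G = sigma_sets (space system_space) boxes" by (rule sets_measure_of[OF pow])
  have "(\<lambda>x. x) \<in> ?G \<rightarrow>\<^sub>M system_space"
  proof (rule measurable_PiM_single')
    show "(\<lambda>x. x) \<in> space ?G \<rightarrow> (\<Pi>\<^sub>E i\<in>{1..C}. space (class_space i))"
      unfolding spG by (simp add: space_PiM[of "{1..C}"])
    fix i assume i: "i \<in> {1..C}"
    show "(\<lambda>x. x i) \<in> ?G \<rightarrow>\<^sub>M class_space i"
    proof (rule measurable_sigma_sets[OF generator_generates[OF i]])
      show "generator i \<subseteq> Pow (space (class_space i))"
        using generator_subset[OF i] sets.space_closed by blast
      show "(\<lambda>x. x i) \<in> space ?G \<rightarrow> space (class_space i)"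
        unfolding spG using i by (auto simp: space_PiM[of "{1..C}"])
      fix A assume A: "A \<in> generator i"
      then have AS: "A \<subseteq> space (class_space i)"
        using generator_subset[OF i] sets.sets_into_space by blast
      let ?F = "\<lambda>j. if j = i then A else space (class_space j)"
      have "(\<lambda>x. x i) -` A \<inter> space ?G = Pi\<^sub>E {1..C} ?F"
      proof (intro antisym subsetI)
        fix x assume "x \<in> (\<lambda>x. x i) -` A \<inter> space ?G"
        then show "x \<in> Pi\<^sub>E {1..C} ?F" unfolding spG by (simp add: space_PiM[of "{1..C}"] PiE_iff)
      next
        fix x assume x: "x \<in> Pi\<^sub>E {1..C} ?F"
        moreover have "Pi\<^sub>E {1..C} ?F \<subseteq> space system_space"
          unfolding space_PiM[of "{1..C}"] by (rule PiE_mono) (simp add: AS)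
        moreover have "x i \<in> A" using PiE_mem[OF x i] by simp
        ultimately show "x \<in> (\<lambda>x. x i) -` A \<inter> space ?G" unfolding spG by blast
      qed
      moreover have "Pi\<^sub>E {1..C} ?F \<in> boxes"
        unfolding boxes_def using A space_in_generator by (intro CollectI exI[of _ ?F]) auto
      ultimately show "(\<lambda>x. x i) -` A \<inter> space ?G \<in> sets ?G"
        unfolding seG by (simp add: sigma_sets.Basic)
    qed
  qed
  then have "sets system_space \<subseteq> sets ?G"
    using spG by (rule sets_subset_of_measurable_ident)
  then show ?thesis
    unfolding seG using sets.sigma_sets_subset[OF boxes_subset] by blast
qed

lemma permuted_system_id: "permuted_system (\<lambda>_. id) \<omega> = (\<lambda>i\<in>{1..C}. \<lambda>n\<in>idx (N i). X \<omega> i n)"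
  by (simp only: permuted_system_def permuted_class_def id_apply)

text \<open>For fixed \<open>B\<close> both sides are finite measures in \<open>A\<close>: the law
  of the system under \<open>M\<close> weighted by the vector event, and the product kernel mixed
  over the same weighted measure. They agree on boxes, where the kernel factorises over classes.
  Leaving the weight unnormalised covers null events as well.\<close>

lemma conditional_law:
  assumes A: "A \<in> sets system_space" and B: "B \<in> sets (PiM {1..C} (\<lambda>i. prob_algebra (borel_of (S i))))"
  shows "emeasure M {\<omega> \<in> space M. permuted_system (\<lambda>_. id) \<omega> \<in> A \<and> (\<lambda>i\<in>{1..C}. \<Lambda> i \<omega>) \<in> B}
    = (\<integral>\<^sup>+\<omega>. indicator B (\<lambda>i\<in>{1..C}. \<Lambda> i \<omega>) * emeasure (PiM {1..C} (\<lambda>i. Q i \<omega>)) A \<partial>M)"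
proof -
  let ?Y = "permuted_system (\<lambda>_. id)"
  let ?E = "vector_event B"
  let ?M = "density M (\<lambda>\<omega>. ennreal (indicator ?E \<omega>))"
  let ?K = "\<lambda>\<omega>. PiM {1..C} (\<lambda>i. Q i \<omega>)"
  let ?\<nu>1 = "distr ?M system_space ?Y"
  let ?\<nu>2 = "?M \<bind> ?K"
  note E = sets_vector_event[OF B]
  note Y = measurable_permuted_system[OF system_perm_id]
  have K: "?K \<in> M \<rightarrow>\<^sub>M prob_algebra system_space"
    by (rule measurable_PiM_prob_algebra) (rule measurable_Q)
  have K': "?K \<in> ?M \<rightarrow>\<^sub>M subprob_algebra system_space"
    using measurable_prob_algebraD[OF K] by (simp cong: measurable_cong_sets)
  have ne: "space ?M \<noteq> {}" using not_empty by simp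
  have \<nu>1: "emeasure ?\<nu>1 D = emeasure M {\<omega> \<in> space M. ?Y \<omega> \<in> D \<and> \<omega> \<in> ?E}" if "D \<in> sets system_space" for D
    by (rule emeasure_distr_density_indicator[OF Y E that])
  have \<nu>2: "emeasure ?\<nu>2 D = (\<integral>\<^sup>+\<omega>. indicator ?E \<omega> * emeasure (?K \<omega>) D \<partial>M)" if D: "D \<in> sets system_space" for D
  proof -
    have "emeasure ?\<nu>2 D = (\<integral>\<^sup>+\<omega>. emeasure (?K \<omega>) D \<partial>?M)"
      by (rule emeasure_bind[OF ne K' D])
    also have "\<dots> = (\<integral>\<^sup>+\<omega>. ennreal (indicator ?E \<omega>) * emeasure (?K \<omega>) D \<partial>M)"
      using E measurable_compose[OF measurable_prob_algebraD[OF K] measurable_emeasure_subprob_algebra[OF D]]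
      by (intro nn_integral_density) auto
    finally show ?thesis by (simp add: ennreal_indicator)
  qed
  have "?\<nu>1 = ?\<nu>2"
  \<comment> \<open>The total mass is at most 1 and the whole space is itself a box, so a constant
    sequence serves as the exhausting one.\<close>
  proof (rule measure_eqI_generator_eq[OF Int_stable_boxes])
    show "boxes \<subseteq> Pow (space system_space)" using boxes_subset sets.space_closed by blast
    show "sets ?\<nu>1 = sigma_sets (space system_space) boxes" by (simp add: boxes_generate)
    show "sets ?\<nu>2 = sigma_sets (space system_space) boxes"
      using sets_bind[of ?M ?K system_space] ne measurable_space[OF K']
      by (simp add: boxes_generate space_subprob_algebra)
    show "range (\<lambda>_::nat. space system_space) \<subseteq> boxes" using space_in_boxes by auto
    show "(\<Union>_::nat. space system_space) = space system_space" by simp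
    show "emeasure ?\<nu>1 (space system_space) \<noteq> \<infinity>"
      unfolding \<nu>1[OF sets.top] using emeasure_finite by simp
    fix D assume D: "D \<in> boxes"
    then have DS: "D \<in> sets system_space" using boxes_subset by blast
    from D obtain F where F: "\<And>i. i \<in> {1..C} \<Longrightarrow> F i \<in> generator i" and D_eq: "D = Pi\<^sub>E {1..C} F"
      unfolding boxes_def by blast
    have Fs: "F i \<in> sets (class_space i)" if "i \<in> {1..C}" for i
      using generator_subset[OF that] F[OF that] by blast
    have id: "class_perm i id" for i by (rule class_perm_id)
    have set_eq: "(\<integral>\<omega>. indicator ?E \<omega> * (\<Prod>i\<in>{1..C}. indicator (F i) (permuted_class id i \<omega>)) \<partial>M)
      = measure M {\<omega> \<in> space M. ?Y \<omega> \<in> D \<and> \<omega> \<in> ?E}"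
    proof -
      have "{\<omega> \<in> space M. ?Y \<omega> \<in> D \<and> \<omega> \<in> ?E} = (?Y -` D \<inter> space M) \<inter> ?E" by auto
      then have ms: "{\<omega> \<in> space M. ?Y \<omega> \<in> D \<and> \<omega> \<in> ?E} \<in> sets M"
        using measurable_sets[OF Y DS] E by simp
      have "indicator ?E \<omega> * (\<Prod>i\<in>{1..C}. indicator (F i) (permuted_class id i \<omega>))
        = (indicator {\<omega> \<in> space M. ?Y \<omega> \<in> D \<and> \<omega> \<in> ?E} \<omega> :: real)" if \<omega>: "\<omega> \<in> space M" for \<omega>
      proof -
        have iff: "?Y \<omega> \<in> D \<longleftrightarrow> (\<forall>i\<in>{1..C}. permuted_class id i \<omega> \<in> F i)"
          unfolding D_eq permuted_system_def by (simp add: PiE_iff)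
        show ?thesis
        proof (cases "?Y \<omega> \<in> D")
          case False
          then obtain i where "i \<in> {1..C}" "permuted_class id i \<omega> \<notin> F i" using iff by blast
          then have "(\<Prod>i\<in>{1..C}. indicator (F i) (permuted_class id i \<omega>) :: real) = 0"
            by (intro prod_zero bexI[of _ i]) auto
          then show ?thesis using False by (simp add: indicator_def)
        next
          case True
          then have "(\<Prod>i\<in>{1..C}. indicator (F i) (permuted_class id i \<omega>) :: real) = 1"
            using iff by (intro prod.neutral) auto
          then show ?thesis using True \<omega> by (simp add: indicator_def)
        qed
      qed
      then have "(\<integral>\<omega>. indicator ?E \<omega> * (\<Prod>i\<in>{1..C}. indicator (F i) (permuted_class id i \<omega>)) \<partial>M)
        = (\<integral>\<omega>. indicator {\<omega> \<in> space M. ?Y \<omega> \<in> D \<and> \<omega> \<in> ?E} \<omega> \<partial>M :: real)"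
        by (intro Bochner_Integration.integral_cong refl)
      also have "\<dots> = measure M {\<omega> \<in> space M. ?Y \<omega> \<in> D \<and> \<omega> \<in> ?E}"
        using ms by simp
      finally show ?thesis .
    qed
    have Qm: "(\<lambda>\<omega>. measure (Q i \<omega>) (F i)) \<in> borel_measurable M" if "i \<in> {1..C}" for i
      by (rule measurable_compose[OF measurable_prob_algebraD[OF measurable_Q[OF that]] measurable_measure_subprob_algebra[OF Fs[OF that]]])
    have Qb: "0 \<le> measure (Q i \<omega>) (F i) \<and> measure (Q i \<omega>) (F i) \<le> 1" if "i \<in> {1..C}" "\<omega> \<in> space M" for i \<omega>
      using prob_space.prob_le_1[OF Q_prob(1)[OF that]] by simp
    have int: "integrable M (\<lambda>\<omega>. indicator ?E \<omega> * (\<Prod>i\<in>{1..C}. measure (Q i \<omega>) (F i)))"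
      by (rule integrable_vector_event_prod(1)[OF E]) (rule Qm Qb; assumption)+
    have "emeasure ?\<nu>1 D = ennreal (measure M {\<omega> \<in> space M. ?Y \<omega> \<in> D \<and> \<omega> \<in> ?E})"
      unfolding \<nu>1[OF DS] by (rule emeasure_eq_measure)
    also have "\<dots> = ennreal (\<integral>\<omega>. indicator ?E \<omega> * (\<Prod>i\<in>{1..C}. measure (Q i \<omega>) (F i)) \<partial>M)"
      using integral_test_limit[OF B generator_test_limit[OF _ F]] unfolding set_eq by simp
    also have "\<dots> = (\<integral>\<^sup>+\<omega>. ennreal (indicator ?E \<omega> * (\<Prod>i\<in>{1..C}. measure (Q i \<omega>) (F i))) \<partial>M)"
      by (rule nn_integral_eq_integral[OF int, symmetric])
        (auto intro!: AE_I2 mult_nonneg_nonneg prod_nonneg)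
    also have "\<dots> = (\<integral>\<^sup>+\<omega>. indicator ?E \<omega> * emeasure (?K \<omega>) D \<partial>M)"
    proof (rule nn_integral_cong)
      fix \<omega> assume \<omega>: "\<omega> \<in> space M"
      have "emeasure (?K \<omega>) D = (\<Prod>i\<in>{1..C}. emeasure (Q i \<omega>) (F i))"
        unfolding D_eq by (rule emeasure_PiM_PiE) (auto simp: Q_prob[OF _ \<omega>] Fs)
      also have "\<dots> = (\<Prod>i\<in>{1..C}. ennreal (measure (Q i \<omega>) (F i)))"
        by (intro prod.cong refl finite_measure.emeasure_eq_measure prob_space.finite_measure Q_prob(1) \<omega>)
      also have "\<dots> = ennreal (\<Prod>i\<in>{1..C}. measure (Q i \<omega>) (F i))"
        by (rule prod_ennreal) simp
      finally show "ennreal (indicator ?E \<omega> * (\<Prod>i\<in>{1..C}. measure (Q i \<omega>) (F i)))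
        = indicator ?E \<omega> * emeasure (?K \<omega>) D"
        by (simp add: indicator_def)
    qed
    also have "\<dots> = emeasure ?\<nu>2 D" by (rule \<nu>2[OF DS, symmetric])
    finally show "emeasure ?\<nu>1 D = emeasure ?\<nu>2 D" .
  qed
  then have "emeasure M {\<omega> \<in> space M. ?Y \<omega> \<in> A \<and> \<omega> \<in> ?E} = (\<integral>\<^sup>+\<omega>. indicator ?E \<omega> * emeasure (?K \<omega>) A \<partial>M)"
    using \<nu>1[OF A] \<nu>2[OF A] by simp
  moreover have "{\<omega> \<in> space M. ?Y \<omega> \<in> A \<and> \<omega> \<in> ?E}
    = {\<omega> \<in> space M. ?Y \<omega> \<in> A \<and> (\<lambda>i\<in>{1..C}. \<Lambda> i \<omega>) \<in> B}"
    unfolding vector_event_def by blast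
  moreover have "(\<integral>\<^sup>+\<omega>. indicator ?E \<omega> * emeasure (?K \<omega>) A \<partial>M)
    = (\<integral>\<^sup>+\<omega>. indicator B (\<lambda>i\<in>{1..C}. \<Lambda> i \<omega>) * emeasure (?K \<omega>) A \<partial>M)"
    by (intro nn_integral_cong) (simp add: vector_event_def indicator_def)
  ultimately show ?thesis by simp
qed

end

theorem theorem3:
  fixes M :: "'w measure" and C :: nat and N :: "nat \<Rightarrow> enat"
    and S :: "nat \<Rightarrow> 'a topology" and X :: "'w \<Rightarrow> nat \<Rightarrow> nat \<Rightarrow> 'a"
    and \<Lambda> :: "nat \<Rightarrow> 'w \<Rightarrow> 'a measure"
  assumes "prob_space M"
    and "C \<ge> 1"
    and "\<forall>i\<in>{1..C}. N i \<ge> 1"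
    and "\<forall>i\<in>{1..C}. Polish_space (S i)"
    and "\<forall>i\<in>{1..C}. \<forall>n\<in>idx (N i). (\<lambda>\<omega>. X \<omega> i n) \<in> M \<rightarrow>\<^sub>M borel_of (S i)"
    and "multi_exchangeable M C N S X"
    and "measure_vector M C N S X \<Lambda>"
  shows "(\<forall>i\<in>{1..C}. \<exists>F. F \<in> prob_algebra (borel_of (S i)) \<rightarrow>\<^sub>M
                            prob_algebra (PiM (idx (N i)) (\<lambda>_. borel_of (S i))) \<and>
             (\<forall>\<omega>\<in>space M. Q_meas N S X \<Lambda> i \<omega> = F (\<Lambda> i \<omega>)))
       \<and> (\<forall>A\<in>sets (PiM {1..C} (\<lambda>i. PiM (idx (N i)) (\<lambda>_. borel_of (S i)))).
          \<forall>B\<in>sets (PiM {1..C} (\<lambda>i. prob_algebra (borel_of (S i)))).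
            emeasure M {\<omega>\<in>space M. (\<lambda>i\<in>{1..C}. \<lambda>n\<in>idx (N i). X \<omega> i n) \<in> A
                                   \<and> (\<lambda>i\<in>{1..C}. \<Lambda> i \<omega>) \<in> B}
            = (\<integral>\<^sup>+\<omega>. indicator B (\<lambda>i\<in>{1..C}. \<Lambda> i \<omega>)
                       * emeasure (PiM {1..C} (\<lambda>i. Q_meas N S X \<Lambda> i \<omega>)) A \<partial>M))"
proof -
  interpret prob_space M by fact
  interpret multi_exchangeable_system M C N S X \<Lambda>
    by standard (use assms in blast)+
  show ?thesis
  proof (intro conjI ballI)
    fix i assume i: "i \<in> {1..C}"
    show "\<exists>F. F \<in> prob_algebra (borel_of (S i)) \<rightarrow>\<^sub>M prob_algebra (PiM (idx (N i)) (\<lambda>_. borel_of (S i))) \<and>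
      (\<forall>\<omega>\<in>space M. Q_meas N S X \<Lambda> i \<omega> = F (\<Lambda> i \<omega>))"
      by (rule Q_function_of_Lambda[OF i]) blast
  qed (rule conditional_law[unfolded permuted_system_id])
qed

end
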